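(* Let $Q_1$ and $Q_2$ be forms of discriminants $\Delta_1$ and $\Delta_2$, respectively, and suppose that the class numbers $h(\Delta_1)$ and $h(\Delta_2)$ are both odd. Then there are infinitely many integers $m$ represented by both $Q_1$ and $Q_2$.
   Context: Conventions: "form" means an integral, binary, positive definite, primitive, reduced quadratic form $Q(x,y)=ax^2+bxy+cy^2$ with $a,b,c\in\mathbb{Z}$. Primitive means $\gcd(a,b,c)=1$; reduced means $|b|\leq a\leq c$, and $b\geq 0$ if $|b|=a$ or $a=c$. The discriminant is $\Delta=b^2-4ac<0$. $Q$ represents an integer $m$ if $Q(x,y)=m$ for some $x,y\in\mathbb{Z}$. The class number $h(\Delta)$ is the number of forms of discriminant $\Delta$ (equivalently, of proper equivalence classes of primitive positive definite binary quadratic forms of discriminant $\Delta$). *)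

theory Defs
  imports Complex_Main
begin

record bqf =
  coeff_a :: int
  coeff_b :: int
  coeff_c :: int

definition bqf_eval :: "bqf \<Rightarrow> int \<Rightarrow> int \<Rightarrow> int" where
  "bqf_eval Q x y = coeff_a Q * x\<^sup>2 + coeff_b Q * x * y + coeff_c Q * y\<^sup>2"

definition bqf_disc :: "bqf \<Rightarrow> int" where
  "bqf_disc Q = (coeff_b Q)\<^sup>2 - 4 * coeff_a Q * coeff_c Q"

definition bqf_positive_definite :: "bqf \<Rightarrow> bool" where
  "bqf_positive_definite Q \<longleftrightarrow> (\<forall>x y. (x, y) \<noteq> (0, 0) \<longrightarrow> bqf_eval Q x y > 0)"

definition bqf_primitive :: "bqf \<Rightarrow> bool" where
  "bqf_primitive Q \<longleftrightarrow> Gcd {coeff_a Q, coeff_b Q, coeff_c Q} = 1"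

definition bqf_reduced :: "bqf \<Rightarrow> bool" where
  "bqf_reduced Q \<longleftrightarrow>
     \<bar>coeff_b Q\<bar> \<le> coeff_a Q \<and> coeff_a Q \<le> coeff_c Q \<and>
     (\<bar>coeff_b Q\<bar> = coeff_a Q \<or> coeff_a Q = coeff_c Q \<longrightarrow> coeff_b Q \<ge> 0)"

text \<open>Positive definiteness is tested on integer arguments only. For a reduced form this is the
  same as positive definiteness over the reals together with a negative discriminant
  (see \<open>bqf_form_disc_neg\<close> below).\<close>

definition bqf_form :: "bqf \<Rightarrow> bool" where
  "bqf_form Q \<longleftrightarrow> bqf_positive_definite Q \<and> bqf_primitive Q \<and> bqf_reduced Q"

definition bqf_represents :: "bqf \<Rightarrow> int \<Rightarrow> bool" where
  "bqf_represents Q m \<longleftrightarrow> (\<exists>x y. bqf_eval Q x y = m)"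

definition class_number :: "int \<Rightarrow> nat" where
  "class_number D = card {Q. bqf_form Q \<and> bqf_disc Q = D}"

lemma bqf_form_coeff_bounds:
  assumes "bqf_form Q"
  shows "0 < coeff_a Q" "\<bar>coeff_b Q\<bar> \<le> coeff_a Q" "coeff_a Q \<le> coeff_c Q"
    and "3 * (coeff_a Q * coeff_c Q) \<le> - bqf_disc Q"
proof -
  have "bqf_eval Q 1 0 > 0"
    using assms unfolding bqf_form_def bqf_positive_definite_def by simp
  then show a: "0 < coeff_a Q"
    by (simp add: bqf_eval_def)
  show b: "\<bar>coeff_b Q\<bar> \<le> coeff_a Q" and c: "coeff_a Q \<le> coeff_c Q"
    using assms by (auto simp: bqf_form_def bqf_reduced_def)
  have "(coeff_b Q)\<^sup>2 = \<bar>coeff_b Q\<bar> * \<bar>coeff_b Q\<bar>"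
    by (simp add: power2_eq_square)
  also have "\<dots> \<le> coeff_a Q * coeff_c Q"
    using a b c by (intro mult_mono) auto
  finally show "3 * (coeff_a Q * coeff_c Q) \<le> - bqf_disc Q"
    by (simp add: bqf_disc_def)
qed

lemma bqf_form_disc_neg:
  assumes "bqf_form Q"
  shows "bqf_disc Q < 0"
proof -
  have "0 < coeff_a Q * coeff_c Q"
    using bqf_form_coeff_bounds[OF assms] by (intro mult_pos_pos) auto
  then show ?thesis
    using bqf_form_coeff_bounds(4)[OF assms] by linarith
qed

text \<open>The set counted by \<open>class_number\<close> is finite, so \<open>card\<close> is not taking its default value.\<close>

lemma finite_bqf_forms: "finite {Q. bqf_form Q \<and> bqf_disc Q = D}"
proof (rule finite_subset)
  let ?I = "{-\<bar>D\<bar>..\<bar>D\<bar>}"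
  show "{Q. bqf_form Q \<and> bqf_disc Q = D} \<subseteq>
        (\<lambda>(a, b, c). \<lparr>coeff_a = a, coeff_b = b, coeff_c = c\<rparr>) ` (?I \<times> ?I \<times> ?I)"
  proof
    fix Q assume "Q \<in> {Q. bqf_form Q \<and> bqf_disc Q = D}"
    then have f: "bqf_form Q" and D: "bqf_disc Q = D" by auto
    note * = bqf_form_coeff_bounds[OF f]
    have "1 * coeff_c Q \<le> coeff_a Q * coeff_c Q"
      using * by (intro mult_right_mono) auto
    then have "coeff_c Q \<le> \<bar>D\<bar>"
      using * D by linarith
    then have "(coeff_a Q, coeff_b Q, coeff_c Q) \<in> ?I \<times> ?I \<times> ?I"
      using * by auto
    then show "Q \<in> (\<lambda>(a, b, c). \<lparr>coeff_a = a, coeff_b = b, coeff_c = c\<rparr>) ` (?I \<times> ?I \<times> ?I)"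
      by (intro image_eqI[where x = "(coeff_a Q, coeff_b Q, coeff_c Q)"]) auto
  qed
qed auto

end

theory Submission
  imports Defs "HOL-Computational_Algebra.Group_Closure" "HOL-Algebra.Multiplicative_Group"
begin

text \<open>A form whose class number is odd represents a positive square. Once this is known, say \<open>Q1\<close>
represents \<open>k1\<^sup>2\<close> and \<open>Q2\<close> represents \<open>k2\<^sup>2\<close>, scaling the arguments shows that both represent
\<open>(k1 k2 t)\<^sup>2\<close> for every \<open>t\<close>, and these are infinitely many integers.

The square comes from the class group: in a group of odd order every element is a square, and if the
class of \<open>Q\<close> is the square of the class of \<open>R\<close>, then \<open>Q\<close> represents the square of every integer
that \<open>R\<close> represents. Composition of forms is realised by multiplication of lattices. Fix a
discriminant \<open>D < 0\<close>, let \<open>O = \<int> + \<int>\<omega>\<close> be the quadratic order of discriminant \<open>D\<close> in \<open>\<complex>\<close>, and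
call a subgroup \<open>M\<close> of \<open>\<complex>\<close> with \<open>\<omega> M \<subseteq> M\<close> invertible if the product of \<open>M\<close> with its complex
conjugate is \<open>r O\<close> for some real \<open>r > 0\<close>. Closure under products and inverses is then immediate
(\<open>comm_group_lattice_group\<close>), whereas a composition law written in coefficients would be laborious.
The lattices \<open>l O\<close> with \<open>l \<noteq> 0\<close> form a subgroup, whose cosets are the homothety classes.

A form \<open>(a, b, c)\<close> of discriminant \<open>D\<close> gives the invertible lattice \<open>\<int> + \<int>\<tau>\<close> with
\<open>\<tau> = (b + \<surd>D) / (2 a)\<close>, on which \<open>\<bar>x + y \<tau>\<bar>\<^sup>2 = Q(x, y) / a\<close>. The number of homothety classes is
\<open>class_number D\<close> (\<open>order_class_group\<close>), for two reasons.
Every class contains the lattice of a reduced form (\<open>invertible_lattice_reduced_form\<close>): a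
shortest nonzero vector and a shortest vector off the line through it form a basis, and the equation
\<open>M M' = r O\<close>, with \<open>M'\<close> the conjugate of \<open>M\<close>, forces the quotient of the two vectors to be the
root of a primitive form of discriminant exactly \<open>D\<close>.
Reduced forms with homothetic lattices are equal (\<open>homothetic_forms_eq\<close>): a homothety yields a
unimodular substitution between the forms, and the outer coefficients \<open>a\<close> and \<open>c\<close> of a reduced form
are determined as its successive minima.

Finally, if \<open>M M = l L\<close> for the lattice \<open>L\<close> of \<open>Q\<close> and \<open>\<alpha>\<close> is a nonzero element of \<open>M\<close>, then
\<open>\<bar>\<alpha>\<bar>\<^sup>2 = r k\<close> with \<open>k\<close> a positive integer, and \<open>\<alpha>\<^sup>2 / l\<close> is an element of \<open>L\<close> at which \<open>Q\<close> takes
the value \<open>k\<^sup>2\<close> (\<open>odd_class_number_represents_square\<close>).\<close>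

section \<open>Reduced forms are unique in their class\<close>

text \<open>The coefficient \<open>c\<close> is the second minimum of a reduced form. With \<open>X = \<bar>x\<bar>\<close> and \<open>Y = \<bar>y\<bar>\<close>, the estimate
\<open>\<bar>b x y\<bar> \<le> a X Y\<close> bounds the value below by \<open>c Y\<^sup>2 - a X (Y - X)\<close>. For \<open>X \<ge> Y\<close> the subtracted term is at
most \<open>0\<close>; for \<open>X < Y\<close> replace \<open>a\<close> by \<open>c\<close> and use that \<open>Y\<^sup>2 - X (Y - X)\<close> is a positive integer.\<close>

lemma bqf_form_eval_ge_c:
  assumes "bqf_form Q" "y \<noteq> 0"
  shows "bqf_eval Q x y \<ge> coeff_c Q"
proof -
  define a b c where "a = coeff_a Q" and "b = coeff_b Q" and "c = coeff_c Q"
  note * = bqf_form_coeff_bounds[OF assms(1), folded a_def b_def c_def]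
  define X Y where "X = \<bar>x\<bar>" and "Y = \<bar>y\<bar>"
  have X: "X \<ge> 0" and Y: "Y \<ge> 1" using assms(2) by (auto simp: X_def Y_def)
  have "\<bar>b * x * y\<bar> \<le> a * (X * Y)"
    unfolding X_def Y_def abs_mult using *(2) by (simp add: mult.assoc mult_right_mono)
  then have "bqf_eval Q x y \<ge> a * X\<^sup>2 - a * (X * Y) + c * Y\<^sup>2"
    unfolding bqf_eval_def a_def[symmetric] b_def[symmetric] c_def[symmetric] X_def Y_def
    by (simp add: abs_le_iff)
  also have "a * X\<^sup>2 - a * (X * Y) + c * Y\<^sup>2 = c * Y\<^sup>2 - a * (X * (Y - X))"
    by (simp add: algebra_simps power2_eq_square)
  finally have 1: "bqf_eval Q x y \<ge> c * Y\<^sup>2 - a * (X * (Y - X))" .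
  have "c * Y\<^sup>2 - a * (X * (Y - X)) \<ge> c"
  proof (cases "X \<ge> Y")
    case True
    have "a * (X * (Y - X)) \<le> 0"
      using True X * by (simp add: mult_le_0_iff mult_nonneg_nonpos)
    moreover have "c * 1 \<le> c * Y\<^sup>2"
      using Y * by (intro mult_left_mono) auto
    ultimately show ?thesis by linarith
  next
    case False
    have "a * (X * (Y - X)) \<le> c * (X * (Y - X))"
      using False X * by (intro mult_right_mono) auto
    moreover have "c * 1 \<le> c * (Y\<^sup>2 - X * (Y - X))"
    proof (rule mult_left_mono)
      have "Y\<^sup>2 - X * (Y - X) = (Y - X)\<^sup>2 + X * Y"
        by (simp add: algebra_simps power2_eq_square)
      moreover have "(Y - X)\<^sup>2 > 0" "X * Y \<ge> 0" using False X Y by auto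
      ultimately show "1 \<le> Y\<^sup>2 - X * (Y - X)" by linarith
    qed (use * in auto)
    ultimately show ?thesis by (simp add: algebra_simps)
  qed
  with 1 show ?thesis by (simp add: c_def)
qed

lemma bqf_form_eval_ge_a:
  assumes "bqf_form Q" "(x, y) \<noteq> (0, 0)"
  shows "bqf_eval Q x y \<ge> coeff_a Q"
proof (cases "y = 0")
  case True
  then have "x\<^sup>2 > 0" using assms by auto
  then have "coeff_a Q * 1 \<le> coeff_a Q * x\<^sup>2"
    using bqf_form_coeff_bounds(1)[OF assms(1)] by (intro mult_left_mono) linarith+
  then show ?thesis using True by (simp add: bqf_eval_def)
next
  case False
  then show ?thesis
    using bqf_form_eval_ge_c[OF assms(1) False, of x] bqf_form_coeff_bounds[OF assms(1)] by linarith
qed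

text \<open>One half of the invariance of the two minima; the inverse substitution gives the other half. If the
vector \<open>(r, s)\<close> at which \<open>Q'\<close> takes the value \<open>c\<close> of \<open>Q\<close> lies on the first axis, then \<open>(p, q)\<close> does not,
and already the smaller value \<open>a\<close> of \<open>Q\<close> is at least the second minimum of \<open>Q'\<close>.\<close>

lemma bqf_form_outer_coeffs_le:
  assumes Q: "bqf_form Q" and Q': "bqf_form Q'" and det: "p * s - q * r = 1"
    and ev: "\<And>x y. bqf_eval Q x y = bqf_eval Q' (p * x + r * y) (q * x + s * y)"
  shows "coeff_a Q' \<le> coeff_a Q" "coeff_c Q' \<le> coeff_c Q"
proof -
  have a: "coeff_a Q = bqf_eval Q' p q" using ev[of 1 0] by (simp add: bqf_eval_def)
  have c: "coeff_c Q = bqf_eval Q' r s" using ev[of 0 1] by (simp add: bqf_eval_def)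
  have "(p, q) \<noteq> (0, 0)" using det by auto
  then show "coeff_a Q' \<le> coeff_a Q" using bqf_form_eval_ge_a[OF Q'] a by simp
  show "coeff_c Q' \<le> coeff_c Q"
  proof (cases "s = 0")
    case True
    then have "q \<noteq> 0" using det by auto
    then have "coeff_c Q' \<le> coeff_a Q" using bqf_form_eval_ge_c[OF Q'] a by simp
    then show ?thesis using bqf_form_coeff_bounds[OF Q] by linarith
  next
    case False
    then show ?thesis using bqf_form_eval_ge_c[OF Q'] c by simp
  qed
qed

text \<open>The minima determine \<open>a\<close> and \<open>c\<close>, hence \<open>b\<close> up to sign. If the signs differed, the normalisation of
reduced forms would force \<open>\<bar>b\<bar> < a < c\<close>; then only vectors on the first axis take the value \<open>a\<close>, the
substitution is a translation up to sign, and it changes \<open>b\<close> by a multiple of \<open>2 a\<close>,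
whereas a change of sign alters \<open>b\<close> by less than \<open>2 a\<close>.\<close>

lemma properly_equivalent_forms_eq:
  assumes Q: "bqf_form Q" and Q': "bqf_form Q'" and D: "bqf_disc Q = bqf_disc Q'"
    and det: "p * s - q * r = 1"
    and ev: "\<And>x y. bqf_eval Q x y = bqf_eval Q' (p * x + r * y) (q * x + s * y)"
  shows "Q = Q'"
proof -
  have ev': "bqf_eval Q' x y = bqf_eval Q (s * x + (- r) * y) ((- q) * x + p * y)" for x y
  proof -
    have "p * (s * x + (- r) * y) + r * ((- q) * x + p * y) = (p * s - q * r) * x"
      "q * (s * x + (- r) * y) + s * ((- q) * x + p * y) = (p * s - q * r) * y"
      by (simp_all add: algebra_simps)
    then show ?thesis using det by (simp only: ev) simp
  qed
  have det': "s * p - (- q) * (- r) = 1" using det by (simp add: algebra_simps)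
  have a: "coeff_a Q = coeff_a Q'" and c: "coeff_c Q = coeff_c Q'"
    using bqf_form_outer_coeffs_le[OF Q Q' det ev] bqf_form_outer_coeffs_le[OF Q' Q det' ev']
    by linarith+
  have "(coeff_b Q)\<^sup>2 = (coeff_b Q')\<^sup>2"
    using D a c by (simp add: bqf_disc_def)
  then have b: "coeff_b Q = coeff_b Q' \<or> coeff_b Q = - coeff_b Q'"
    by (simp add: power2_eq_iff)
  have "coeff_b Q = coeff_b Q'"
  proof (rule ccontr)
    assume ne: "coeff_b Q \<noteq> coeff_b Q'"
    then have bb: "coeff_b Q = - coeff_b Q'" "coeff_b Q' \<noteq> 0" using b by auto
    have red: "bqf_reduced Q" "bqf_reduced Q'" using Q Q' by (simp_all add: bqf_form_def)
    have "\<not> (coeff_b Q \<ge> 0 \<and> coeff_b Q' \<ge> 0)" using bb by linarith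
    moreover have "\<bar>coeff_b Q\<bar> = \<bar>coeff_b Q'\<bar>" using bb(1) by simp
    ultimately have "\<bar>coeff_b Q'\<bar> \<noteq> coeff_a Q'" "coeff_a Q' \<noteq> coeff_c Q'"
      using red a c unfolding bqf_reduced_def by metis+
    then have strict: "\<bar>coeff_b Q'\<bar> < coeff_a Q'" "coeff_a Q' < coeff_c Q'"
      using bqf_form_coeff_bounds(2,3)[OF Q'] by linarith+
    have "bqf_eval Q' p q = coeff_a Q'" using ev[of 1 0] a by (simp add: bqf_eval_def)
    then have q: "q = 0"
      using bqf_form_eval_ge_c[OF Q', of q p] strict by fastforce
    then have ps: "p * s = 1" using det by simp
    have "bqf_eval Q 1 1 = bqf_eval Q' (p + r) s" using ev[of 1 1] q by simp
    moreover have "bqf_eval Q 1 0 = bqf_eval Q' p 0" "bqf_eval Q 0 1 = bqf_eval Q' r s"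
      using ev[of 1 0] ev[of 0 1] q by simp_all
    ultimately have "coeff_b Q = 2 * coeff_a Q' * (p * r) + coeff_b Q' * (p * s)"
      by (simp add: bqf_eval_def power2_eq_square algebra_simps)
    then have "coeff_b Q' = coeff_a Q' * (- p * r)"
      using bb ps by (simp add: algebra_simps)
    then have "coeff_a Q' dvd coeff_b Q'" by (metis dvd_triv_left)
    then show False using strict bb(2) zdvd_not_zless[of "\<bar>coeff_b Q'\<bar>" "coeff_a Q'"] by simp
  qed
  then show ?thesis using a c by simp
qed

section \<open>Additive subgroups of the complex plane\<close>

definition add_subgroup :: "complex set \<Rightarrow> bool" where
  "add_subgroup S \<longleftrightarrow> 0 \<in> S \<and> (\<forall>x\<in>S. \<forall>y\<in>S. x - y \<in> S)"

text \<open>Pairwise products need not be closed under addition, so the product of two lattices is the subgroup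
that they generate.\<close>

definition lprod :: "complex set \<Rightarrow> complex set \<Rightarrow> complex set" where
  "lprod A B = group_closure {x * y |x y. x \<in> A \<and> y \<in> B}"

definition lscale :: "complex \<Rightarrow> complex set \<Rightarrow> complex set" where
  "lscale l A = (*) l ` A"

definition lat :: "complex \<Rightarrow> complex set" where
  "lat \<tau> = {of_int x + of_int y * \<tau> |x y. True}"

lemma add_subgroupD:
  assumes "add_subgroup S"
  shows "0 \<in> S" "x \<in> S \<Longrightarrow> y \<in> S \<Longrightarrow> x - y \<in> S" "x \<in> S \<Longrightarrow> - x \<in> S"
    "x \<in> S \<Longrightarrow> y \<in> S \<Longrightarrow> x + y \<in> S"
proof -
  have 0: "0 \<in> S" and d: "\<And>x y. x \<in> S \<Longrightarrow> y \<in> S \<Longrightarrow> x - y \<in> S"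
    using assms by (auto simp: add_subgroup_def)
  have m: "- x \<in> S" if "x \<in> S" for x using d[OF 0 that] by simp
  show "0 \<in> S" "x \<in> S \<Longrightarrow> y \<in> S \<Longrightarrow> x - y \<in> S" "x \<in> S \<Longrightarrow> - x \<in> S" by (fact 0 d m)+
  show "x \<in> S \<Longrightarrow> y \<in> S \<Longrightarrow> x + y \<in> S" using d[of x "- y"] m[of y] by simp
qed

lemma add_subgroup_of_int_mult:
  assumes S: "add_subgroup S" and x: "x \<in> S"
  shows "of_int n * x \<in> S"
proof -
  have nat: "of_nat n * x \<in> S" for n
    by (induction n) (auto simp: algebra_simps intro: add_subgroupD[OF S] x)
  show ?thesis
  proof (cases n)
    case (nonneg k) then show ?thesis using nat by simp
  next
    case (neg k) then show ?thesis using add_subgroupD(3)[OF S nat[of "Suc k"]]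
      by (simp only: of_int_minus of_int_of_nat_eq mult_minus_left)
  qed
qed

lemma add_subgroup_group_closure: "add_subgroup (group_closure S)"
  by (auto simp: add_subgroup_def intro: group_closure.diff)

lemma group_closure_subset: "add_subgroup T \<Longrightarrow> S \<subseteq> T \<Longrightarrow> group_closure S \<subseteq> T"
proof
  fix x assume T: "add_subgroup T" "S \<subseteq> T" and "x \<in> group_closure S"
  from this(3) show "x \<in> T"
    by induction (use T in \<open>auto dest: add_subgroupD\<close>)
qed

lemma add_subgroup_lprod: "add_subgroup (lprod A B)"
  by (simp add: lprod_def add_subgroup_group_closure)

lemma lprodI: "x \<in> A \<Longrightarrow> y \<in> B \<Longrightarrow> x * y \<in> lprod A B"
  by (auto simp: lprod_def intro!: group_closure.base)

lemma lprod_subset: "add_subgroup T \<Longrightarrow> (\<And>x y. x \<in> A \<Longrightarrow> y \<in> B \<Longrightarrow> x * y \<in> T) \<Longrightarrow> lprod A B \<subseteq> T"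
  unfolding lprod_def by (rule group_closure_subset) auto

lemma add_subgroup_mult_vimage: "add_subgroup T \<Longrightarrow> add_subgroup {x. x * c \<in> T}"
  by (auto simp: add_subgroup_def algebra_simps)

lemma lprod_commute: "lprod A B = lprod B A"
  unfolding lprod_def by (rule arg_cong[of _ _ group_closure]) (auto, (metis mult.commute)+)

text \<open>For fixed \<open>c\<close> the elements \<open>x\<close> with \<open>x c\<close> in the right-hand side form a subgroup, so it is enough
to test generators of \<open>lprod A B\<close>. The reverse inclusion follows by commutativity.\<close>

lemma lprod_assoc: "lprod (lprod A B) C = lprod A (lprod B C)"
proof -
  have sub: "lprod (lprod A B) C \<subseteq> lprod A (lprod B C)" for A B C
  proof (rule lprod_subset[OF add_subgroup_lprod])
    fix x c assume "x \<in> lprod A B" and c: "c \<in> C"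
    moreover have "lprod A B \<subseteq> {x. x * c \<in> lprod A (lprod B C)}"
      by (rule lprod_subset[OF add_subgroup_mult_vimage[OF add_subgroup_lprod]])
        (auto simp: mult.assoc intro!: lprodI c)
    ultimately show "x * c \<in> lprod A (lprod B C)" by auto
  qed
  show ?thesis
  proof (rule antisym[OF sub])
    show "lprod A (lprod B C) \<subseteq> lprod (lprod A B) C"
      using sub[of C B A] by (simp add: lprod_commute)
  qed
qed

lemma lprod_left_commute: "lprod A (lprod B C) = lprod B (lprod A C)"
  by (metis lprod_assoc lprod_commute)

lemmas lprod_ac = lprod_assoc lprod_commute lprod_left_commute

lemma lprod_lscale_left: "lprod (lscale l A) B = lscale l (lprod A B)"
proof -
  have "{x * y |x y. x \<in> lscale l A \<and> y \<in> B} = times l ` {x * y |x y. x \<in> A \<and> y \<in> B}"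
    by (auto simp: lscale_def image_iff mult.assoc) (metis mult.assoc)+
  then show ?thesis
    unfolding lprod_def by (simp add: group_closure_mult_all_eq lscale_def)
qed

lemma lprod_lscale_right: "lprod A (lscale l B) = lscale l (lprod A B)"
  by (metis lprod_lscale_left lprod_commute)

lemma lscale_lscale: "lscale k (lscale l A) = lscale (k * l) A"
  by (auto simp: lscale_def image_image mult.assoc)

lemma lscale_1 [simp]: "lscale 1 A = A"
  by (simp add: lscale_def)

lemma mem_lscale_iff: "l \<noteq> 0 \<Longrightarrow> x \<in> lscale l A \<longleftrightarrow> x / l \<in> A"
  by (auto simp: lscale_def image_iff intro!: bexI[of _ "x / l"])

lemma add_subgroup_lscale: "add_subgroup A \<Longrightarrow> add_subgroup (lscale l A)"
  unfolding add_subgroup_def lscale_def by (auto simp: right_diff_distrib[symmetric])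

lemma add_subgroup_cnj: "add_subgroup A \<Longrightarrow> add_subgroup (cnj ` A)"
  unfolding add_subgroup_def by (auto simp: complex_cnj_diff[symmetric] image_iff simp del: complex_cnj_diff)

lemma cnj_cnj_image [simp]: "cnj ` cnj ` A = A"
  by (simp add: image_image)

lemma cnj_lprod: "cnj ` lprod A B = lprod (cnj ` A) (cnj ` B)"
proof -
  have sub: "cnj ` lprod A B \<subseteq> lprod (cnj ` A) (cnj ` B)" for A B
  proof -
    have "lprod A B \<subseteq> cnj ` lprod (cnj ` A) (cnj ` B)"
    proof (rule lprod_subset[OF add_subgroup_cnj[OF add_subgroup_lprod]])
      fix x y assume "x \<in> A" "y \<in> B"
      then have "cnj x * cnj y \<in> lprod (cnj ` A) (cnj ` B)" by (intro lprodI) auto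
      then show "x * y \<in> cnj ` lprod (cnj ` A) (cnj ` B)"
        by (metis complex_cnj_cnj complex_cnj_mult imageI)
    qed
    then have "cnj ` lprod A B \<subseteq> cnj ` cnj ` lprod (cnj ` A) (cnj ` B)" by (rule image_mono)
    then show ?thesis by simp
  qed
  show ?thesis
  proof (rule antisym[OF sub])
    have "cnj ` lprod (cnj ` A) (cnj ` B) \<subseteq> lprod A B" using sub[of "cnj ` A" "cnj ` B"] by simp
    then have "cnj ` cnj ` lprod (cnj ` A) (cnj ` B) \<subseteq> cnj ` lprod A B" by (rule image_mono)
    then show "lprod (cnj ` A) (cnj ` B) \<subseteq> cnj ` lprod A B" by simp
  qed
qed

lemma cnj_lscale: "cnj ` lscale l A = lscale (cnj l) (cnj ` A)"
  by (simp add: lscale_def image_image)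

lemma latI: "of_int x + of_int y * \<tau> \<in> lat \<tau>"
  by (auto simp: lat_def)

lemma latE:
  assumes "z \<in> lat \<tau>"
  obtains x y where "z = of_int x + of_int y * \<tau>"
  using assms by (auto simp: lat_def)

lemma add_subgroup_lat: "add_subgroup (lat \<tau>)"
  unfolding add_subgroup_def
proof (intro conjI ballI)
  show "0 \<in> lat \<tau>" using latI[of 0 0 \<tau>] by simp
  fix z w assume "z \<in> lat \<tau>" "w \<in> lat \<tau>"
  then obtain x y x' y' where "z = of_int x + of_int y * \<tau>" "w = of_int x' + of_int y' * \<tau>"
    by (auto elim!: latE)
  then have "z - w = of_int (x - x') + of_int (y - y') * \<tau>" by (simp add: algebra_simps)
  then show "z - w \<in> lat \<tau>" by (simp only: latI)
qed

lemma one_in_lat: "1 \<in> lat \<tau>" using latI[of 1 0 \<tau>] by simp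
lemma gen_in_lat: "\<tau> \<in> lat \<tau>" using latI[of 0 1 \<tau>] by simp

lemma lat_subset: "add_subgroup T \<Longrightarrow> 1 \<in> T \<Longrightarrow> \<tau> \<in> T \<Longrightarrow> lat \<tau> \<subseteq> T"
  by (auto elim!: latE intro!: add_subgroupD(4) add_subgroup_of_int_mult intro: add_subgroup_of_int_mult[of T 1, simplified])

lemma cmod_square_eq: "(complex_of_real (cmod z))\<^sup>2 = z * cnj z"
  using complex_norm_square[of z] by simp

section \<open>The group of invertible lattices of a quadratic order\<close>

text \<open>The divisibility condition says that \<open>D\<close> is \<open>0\<close> or \<open>1\<close> modulo \<open>4\<close>. It is stated in the form in which
it makes the constant term of the minimal polynomial of \<open>\<omega>\<close> an integer.\<close>

locale quadratic_order =
  fixes D :: int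
  assumes D_neg: "D < 0" and D_disc: "4 dvd D * (D - 1)"
begin

definition \<omega> :: complex where
  "\<omega> = Complex (of_int D / 2) (sqrt (of_int (- D)) / 2)"

definition quad_ord :: "complex set" where "quad_ord = lat \<omega>"

text \<open>The norm equation carries the geometry. It makes \<open>M\<close> discrete, because the numbers \<open>\<bar>v\<bar>\<^sup>2\<close> with
\<open>v \<in> M\<close> are integer multiples of \<open>r\<close>, and it gives \<open>M\<close> rank two, because a subset of a real line
through \<open>0\<close> cannot have the non-real number \<open>r \<omega>\<close> in its norm product.\<close>

definition invertible_lattice :: "complex set \<Rightarrow> bool" where
  "invertible_lattice M \<longleftrightarrow> add_subgroup M \<and> (\<forall>x\<in>M. \<omega> * x \<in> M) \<and>
     (\<exists>r::real. r > 0 \<and> lprod M (cnj ` M) = lscale (of_real r) quad_ord)"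

lemma Im_omega: "Im \<omega> > 0" "Im \<omega> = sqrt (of_int (- D)) / 2" "Re \<omega> = of_int D / 2"
  using D_neg by (auto simp: \<omega>_def)

lemma cnj_omega: "cnj \<omega> = of_int D - \<omega>"
  by (simp add: \<omega>_def complex_eq_iff)

lemma omega_sq: "\<exists>n. \<omega> * \<omega> = of_int D * \<omega> - of_int n"
proof -
  from D_disc obtain n where n: "D * (D - 1) = 4 * n" by (auto elim: dvdE)
  have "\<omega> * \<omega> = of_int D * \<omega> - of_int n"
  proof (rule complex_eqI)
    have "sqrt (of_int (- D)) * sqrt (of_int (- D)) = - of_int D" using D_neg by simp
    moreover have "of_int D * (of_int D - 1) = (4::real) * of_int n"
      using arg_cong[OF n, of "of_int :: int \<Rightarrow> real"] by simp
    ultimately show "Re (\<omega> * \<omega>) = Re (of_int D * \<omega> - of_int n)"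
      by (simp add: Im_omega field_simps)
    show "Im (\<omega> * \<omega>) = Im (of_int D * \<omega> - of_int n)" by (simp add: Im_omega)
  qed
  then show ?thesis ..
qed

lemma add_subgroup_quad_ord: "add_subgroup quad_ord" and one_in_quad_ord: "1 \<in> quad_ord" and omega_in_quad_ord: "\<omega> \<in> quad_ord"
  by (simp_all add: quad_ord_def add_subgroup_lat one_in_lat gen_in_lat)

lemma lprod_quad_ord:
  assumes "add_subgroup M" "\<And>x. x \<in> M \<Longrightarrow> \<omega> * x \<in> M"
  shows "lprod quad_ord M = M"
proof
  show "lprod quad_ord M \<subseteq> M"
  proof (rule lprod_subset[OF assms(1)])
    fix z m assume "z \<in> quad_ord" and m: "m \<in> M"
    moreover have "quad_ord \<subseteq> {x. x * m \<in> M}"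
      unfolding quad_ord_def by (rule lat_subset[OF add_subgroup_mult_vimage[OF assms(1)]]) (use assms m in auto)
    ultimately show "z * m \<in> M" by auto
  qed
  show "M \<subseteq> lprod quad_ord M" using lprodI[OF one_in_quad_ord] by fastforce
qed

lemma omega_stable_quad_ord: "x \<in> quad_ord \<Longrightarrow> \<omega> * x \<in> quad_ord"
proof -
  assume x: "x \<in> quad_ord"
  obtain n where n: "\<omega> * \<omega> = of_int D * \<omega> - of_int n" using omega_sq ..
  have "\<omega> * \<omega> \<in> quad_ord" using latI[of "- n" D \<omega>] by (simp add: n quad_ord_def)
  then have "lat \<omega> \<subseteq> {x. x * \<omega> \<in> quad_ord}"
    by (intro lat_subset add_subgroup_mult_vimage add_subgroup_quad_ord) (simp_all add: omega_in_quad_ord)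
  with x show ?thesis by (auto simp: mult.commute quad_ord_def)
qed

lemma lprod_quad_ord_quad_ord: "lprod quad_ord quad_ord = quad_ord"
  by (rule lprod_quad_ord[OF add_subgroup_quad_ord omega_stable_quad_ord])

lemma cnj_quad_ord: "cnj ` quad_ord = quad_ord"
proof -
  have "quad_ord \<subseteq> cnj ` quad_ord"
    unfolding quad_ord_def
  proof (rule lat_subset[OF add_subgroup_cnj[OF add_subgroup_lat]])
    show "1 \<in> cnj ` lat \<omega>" by (rule image_eqI[OF _ one_in_lat]) simp
    show "\<omega> \<in> cnj ` lat \<omega>"
      by (rule image_eqI[OF _ latI[of D "-1" \<omega>]]) (simp add: cnj_omega)
  qed
  then have "cnj ` quad_ord \<subseteq> cnj ` cnj ` quad_ord" by (rule image_mono)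
  with \<open>quad_ord \<subseteq> cnj ` quad_ord\<close> show ?thesis by auto
qed

text \<open>Real elements of the order are integers. This is the source of all integrality statements
about norms and form coefficients.\<close>

lemma real_quad_ordE:
  assumes "of_real t \<in> lscale (of_real s) quad_ord" "s > 0"
  obtains k where "t = s * of_int k"
proof -
  from assms obtain x y where xy: "of_real t = of_real s * (of_int x + of_int y * \<omega>)"
    by (auto simp: lscale_def quad_ord_def elim!: latE)
  from arg_cong[OF this, of Im] have "y = 0" using Im_omega(1) assms(2) by simp
  with arg_cong[OF xy, of Re] show thesis by (intro that[of x]) simp
qed

text \<open>The positive scalar in the norm equation of a lattice is thus determined by the lattice, which allows
norms to be compared. Each of \<open>s\<close> and \<open>t\<close> is an integer multiple of the other.\<close>

lemma lscale_quad_ord_inj: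
  assumes "lscale (of_real s) quad_ord = lscale (of_real t) quad_ord" "s > 0" "t > 0"
  shows "s = t"
proof -
  have "of_real s \<in> lscale (of_real s) quad_ord" "of_real t \<in> lscale (of_real t) quad_ord"
    using one_in_quad_ord by (auto simp: lscale_def)
  then obtain k l where k: "s = t * of_int k" and l: "t = s * of_int l"
    using assms real_quad_ordE by (metis (no_types, lifting))
  then have "s = s * of_int (l * k)" by simp
  then have "of_int (l * k) = (1::real)" using assms by simp
  then have "l * k = 1" by linarith
  moreover have "k > 0" using k assms by (simp add: zero_less_mult_iff)
  ultimately have "k = 1" using pos_zmult_eq_1_iff by (metis mult.commute)
  then show ?thesis using k by simp
qed

definition lattice_group :: "complex set monoid" where
  "lattice_group = \<lparr>carrier = Collect invertible_lattice, mult = lprod, one = quad_ord\<rparr>"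

definition principal_lattices :: "complex set set" where
  "principal_lattices = {lscale l quad_ord |l. l \<noteq> 0}"

lemma invertible_lattice_lprod:
  assumes "invertible_lattice M" "invertible_lattice N"
  shows "invertible_lattice (lprod M N)"
proof -
  obtain r s where r: "r > 0" "lprod M (cnj ` M) = lscale (of_real r) quad_ord"
    and s: "s > 0" "lprod N (cnj ` N) = lscale (of_real s) quad_ord"
    using assms by (auto simp: invertible_lattice_def)
  have "lprod (lprod M N) (cnj ` lprod M N) = lprod (lprod M (cnj ` M)) (lprod N (cnj ` N))"
    by (simp add: cnj_lprod lprod_ac)
  also have "\<dots> = lscale (of_real (r * s)) quad_ord"
    by (simp add: r s lprod_lscale_left lprod_lscale_right lscale_lscale lprod_quad_ord_quad_ord mult.commute)
  finally have 1: "lprod (lprod M N) (cnj ` lprod M N) = lscale (of_real (r * s)) quad_ord" .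
  have 2: "\<omega> * x \<in> lprod M N" if "x \<in> lprod M N" for x
  proof -
    have "lprod M N \<subseteq> {x. x * \<omega> \<in> lprod M N}"
    proof (rule lprod_subset[OF add_subgroup_mult_vimage[OF add_subgroup_lprod]])
      fix x y assume "x \<in> M" "y \<in> N"
      then have "(\<omega> * x) * y \<in> lprod M N" using assms by (intro lprodI) (auto simp: invertible_lattice_def)
      then show "x * y \<in> {x. x * \<omega> \<in> lprod M N}" by (simp add: mult_ac)
    qed
    then show ?thesis using that by (auto simp: mult.commute)
  qed
  show ?thesis
    unfolding invertible_lattice_def using add_subgroup_lprod 2 1 r(1) s(1)
    by (auto intro!: exI[of _ "r * s"])
qed

lemma invertible_lattice_lscale:
  assumes "invertible_lattice M" "l \<noteq> 0"
  shows "invertible_lattice (lscale l M)"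
proof -
  obtain r where r: "r > 0" "lprod M (cnj ` M) = lscale (of_real r) quad_ord"
    using assms by (auto simp: invertible_lattice_def)
  have "lprod (lscale l M) (cnj ` lscale l M) = lscale (l * cnj l * of_real r) quad_ord"
    by (simp add: cnj_lscale lprod_lscale_left lprod_lscale_right lscale_lscale r mult_ac)
  then have "lprod (lscale l M) (cnj ` lscale l M) = lscale (of_real ((cmod l)\<^sup>2 * r)) quad_ord"
    by (simp add: cmod_square_eq)
  moreover have "(cmod l)\<^sup>2 * r > 0" using r assms by simp
  moreover have "\<omega> * x \<in> lscale l M" if "x \<in> lscale l M" for x
  proof -
    have "x / l \<in> M" using that assms by (simp add: mem_lscale_iff)
    then have "\<omega> * (x / l) \<in> M" using assms unfolding invertible_lattice_def by blast
    then show ?thesis using assms by (simp add: mem_lscale_iff)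
  qed
  ultimately show ?thesis
    using assms add_subgroup_lscale[of M l] unfolding invertible_lattice_def by blast
qed

text \<open>The inverse of \<open>M\<close> will be a real multiple of its conjugate. Stability under \<open>\<omega>\<close> passes to the conjugate
because the conjugate of \<open>\<omega>\<close> is \<open>D - \<omega>\<close>.\<close>

lemma invertible_lattice_cnj:
  assumes "invertible_lattice M"
  shows "invertible_lattice (cnj ` M)"
proof -
  obtain r where r: "r > 0" "lprod M (cnj ` M) = lscale (of_real r) quad_ord"
    using assms by (auto simp: invertible_lattice_def)
  have add: "add_subgroup M" using assms by (simp add: invertible_lattice_def)
  have "\<omega> * cnj x \<in> cnj ` M" if "x \<in> M" for x
  proof (rule image_eqI)
    show "of_int D * x - \<omega> * x \<in> M"
      using assms that by (auto simp: invertible_lattice_def intro!: add_subgroupD(2) add_subgroup_of_int_mult)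
    show "\<omega> * cnj x = cnj (of_int D * x - \<omega> * x)" by (simp add: cnj_omega algebra_simps)
  qed
  moreover have "lprod (cnj ` M) (cnj ` cnj ` M) = lscale (of_real r) quad_ord"
    using r(2) lprod_commute by simp
  ultimately show ?thesis
    unfolding invertible_lattice_def using add_subgroup_cnj[OF add] r(1) by auto
qed

lemma invertible_lattice_quad_ord: "invertible_lattice quad_ord"
  unfolding invertible_lattice_def
  by (auto simp: add_subgroup_quad_ord omega_stable_quad_ord cnj_quad_ord lprod_quad_ord_quad_ord intro!: exI[of _ 1])

lemma lprod_quad_ord_invertible: "invertible_lattice M \<Longrightarrow> lprod quad_ord M = M"
  by (rule lprod_quad_ord) (auto simp: invertible_lattice_def)

lemma comm_group_lattice_group: "comm_group lattice_group"
proof (rule comm_groupI)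
  fix M assume "M \<in> carrier lattice_group"
  then have M: "invertible_lattice M" by (simp add: lattice_group_def)
  then obtain r where r: "r > 0" "lprod M (cnj ` M) = lscale (of_real r) quad_ord"
    by (auto simp: invertible_lattice_def)
  show "\<exists>N\<in>carrier lattice_group. N \<otimes>\<^bsub>lattice_group\<^esub> M = \<one>\<^bsub>lattice_group\<^esub>"
  proof
    show "lscale (1 / of_real r) (cnj ` M) \<in> carrier lattice_group"
      using r invertible_lattice_lscale[OF invertible_lattice_cnj[OF M]] by (simp add: lattice_group_def)
    have "lprod (lscale (1 / of_real r) (cnj ` M)) M = lscale (1 / of_real r) (lprod M (cnj ` M))"
      by (simp add: lprod_lscale_left lprod_lscale_right lprod_commute[of _ M])
    then show "lscale (1 / of_real r) (cnj ` M) \<otimes>\<^bsub>lattice_group\<^esub> M = \<one>\<^bsub>lattice_group\<^esub>"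
      using r by (simp add: lattice_group_def lscale_lscale)
  qed
qed (simp_all add: lattice_group_def invertible_lattice_lprod invertible_lattice_quad_ord
      lprod_quad_ord_invertible lprod_assoc, rule lprod_commute)

sublocale L: comm_group lattice_group
  by (rule comm_group_lattice_group)

lemma subgroup_principal_lattices: "subgroup principal_lattices lattice_group"
proof (rule L.subgroupI)
  show "principal_lattices \<subseteq> carrier lattice_group"
    by (auto simp: principal_lattices_def lattice_group_def invertible_lattice_lscale invertible_lattice_quad_ord)
  show "principal_lattices \<noteq> {}" by (auto simp: principal_lattices_def intro: exI[of _ 1])
next
  fix M assume "M \<in> principal_lattices"
  then obtain l where l: "l \<noteq> 0" "M = lscale l quad_ord" by (auto simp: principal_lattices_def)
  have "inv\<^bsub>lattice_group\<^esub> M = lscale (1 / l) quad_ord"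
    by (rule L.inv_equality)
      (use l in \<open>auto simp: lattice_group_def invertible_lattice_lscale invertible_lattice_quad_ord
        lprod_lscale_left lprod_lscale_right lscale_lscale lprod_quad_ord_quad_ord\<close>)
  then show "inv\<^bsub>lattice_group\<^esub> M \<in> principal_lattices" using l by (auto simp: principal_lattices_def intro!: exI[of _ "1 / l"])
next
  fix M N assume "M \<in> principal_lattices" "N \<in> principal_lattices"
  then obtain k l where "k \<noteq> 0" "M = lscale k quad_ord" "l \<noteq> 0" "N = lscale l quad_ord"
    by (auto simp: principal_lattices_def)
  then show "M \<otimes>\<^bsub>lattice_group\<^esub> N \<in> principal_lattices"
    by (auto simp: principal_lattices_def lattice_group_def lprod_lscale_left lprod_lscale_right
        lscale_lscale lprod_quad_ord_quad_ord mult.commute intro!: exI[of _ "k * l"])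
qed

sublocale P: normal principal_lattices lattice_group
  by (rule L.subgroup_imp_normal[OF subgroup_principal_lattices])

text \<open>The elements of the quotient group are therefore the homothety classes.\<close>

lemma rcos_principal_lattices:
  assumes "invertible_lattice M"
  shows "principal_lattices #>\<^bsub>lattice_group\<^esub> M = {lscale l M |l. l \<noteq> 0}"
  unfolding r_coset_def principal_lattices_def
  by (auto simp: lattice_group_def lprod_lscale_left lprod_quad_ord_invertible[OF assms])

end

section \<open>The lattice of a form\<close>

text \<open>The number \<open>(b + \<surd>D) / (2 a)\<close>, a root of \<open>a z\<^sup>2 - b z + c\<close>. The sign of \<open>b\<close> is chosen so that
\<open>\<bar>x + y \<tau>\<bar>\<^sup>2\<close> is \<open>Q(x, y) / a\<close> and not \<open>Q(x, -y) / a\<close>.\<close>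

definition form_root :: "bqf \<Rightarrow> complex" where
  "form_root Q = Complex (of_int (coeff_b Q) / (2 * of_int (coeff_a Q)))
     (sqrt (of_int (- bqf_disc Q)) / (2 * of_int (coeff_a Q)))"

lemma form_root_trace: "form_root Q + cnj (form_root Q) = of_int (coeff_b Q) / of_int (coeff_a Q)"
  by (simp add: form_root_def complex_eq_iff)

lemma form_root_norm:
  assumes "coeff_a Q > 0" "bqf_disc Q < 0"
  shows "form_root Q * cnj (form_root Q) = of_int (coeff_c Q) / of_int (coeff_a Q)"
proof (rule complex_eqI)
  define a b c d :: real where "a = of_int (coeff_a Q)" and "b = of_int (coeff_b Q)"
    and "c = of_int (coeff_c Q)" and "d = sqrt (of_int (- bqf_disc Q))"
  note defs = a_def b_def c_def d_def
  have a: "a \<noteq> 0" using assms by (simp add: defs)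
  have "d\<^sup>2 = of_int (- bqf_disc Q)" using assms by (simp add: defs)
  then have d: "d\<^sup>2 = 4 * a * c - b\<^sup>2" by (simp add: bqf_disc_def defs)
  have "Re (form_root Q * cnj (form_root Q)) = (b\<^sup>2 + d\<^sup>2) / (4 * a\<^sup>2)"
    unfolding form_root_def defs[symmetric]
    by (simp add: add_divide_distrib power2_eq_square)
  also have "\<dots> = c / a" using a unfolding d by (simp add: power2_eq_square)
  finally show "Re (form_root Q * cnj (form_root Q)) = Re (of_int (coeff_c Q) / of_int (coeff_a Q))"
    by (simp add: defs)
qed (simp add: form_root_def)

lemma form_root_square:
  assumes "coeff_a Q > 0" "bqf_disc Q < 0"
  shows "of_int (coeff_a Q) * (form_root Q * form_root Q) =
    of_int (coeff_b Q) * form_root Q - of_int (coeff_c Q)"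
proof -
  have a: "of_int (coeff_a Q) \<noteq> (0::complex)" using assms by simp
  have "form_root Q * form_root Q =
      (form_root Q + cnj (form_root Q)) * form_root Q - form_root Q * cnj (form_root Q)"
    by (simp add: algebra_simps)
  also have "\<dots> = (of_int (coeff_b Q) * form_root Q - of_int (coeff_c Q)) / of_int (coeff_a Q)"
    unfolding form_root_trace form_root_norm[OF assms] by (simp add: diff_divide_distrib)
  finally show ?thesis using a by (simp add: field_simps)
qed

lemma bqf_eval_form_root:
  assumes "coeff_a Q > 0" "bqf_disc Q < 0"
  shows "of_int (bqf_eval Q x y) =
    of_int (coeff_a Q) * (cmod (of_int x + of_int y * form_root Q))\<^sup>2"
proof -
  define \<tau> where "\<tau> = form_root Q"
  have a: "of_int (coeff_a Q) \<noteq> (0::complex)" using assms by simp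
  have "complex_of_real ((cmod (of_int x + of_int y * \<tau>))\<^sup>2) =
      (of_int x)\<^sup>2 + of_int x * of_int y * (\<tau> + cnj \<tau>) + (of_int y)\<^sup>2 * (\<tau> * cnj \<tau>)"
    unfolding complex_norm_square by (simp add: algebra_simps power2_eq_square)
  also have "of_int (coeff_a Q) * \<dots> = of_int (bqf_eval Q x y)"
    unfolding form_root_trace form_root_norm[OF assms] \<tau>_def
    using a by (simp add: bqf_eval_def field_simps)
  finally have "complex_of_real (of_int (coeff_a Q) * (cmod (of_int x + of_int y * \<tau>))\<^sup>2) =
      complex_of_real (of_int (bqf_eval Q x y))" by simp
  then show ?thesis unfolding \<tau>_def of_real_eq_iff by simp
qed

lemma bqf_positive_definiteI:
  assumes "coeff_a Q > 0" "bqf_disc Q < 0"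
  shows "bqf_positive_definite Q"
  unfolding bqf_positive_definite_def
proof (intro allI impI)
  fix x y :: int assume xy: "(x, y) \<noteq> (0, 0)"
  have "of_int x + of_int y * form_root Q \<noteq> 0"
  proof
    assume eq: "of_int x + of_int y * form_root Q = 0"
    from arg_cong[OF eq, of Im] have "y = 0" using assms by (simp add: form_root_def)
    with eq xy show False by simp
  qed
  then have "(of_int (bqf_eval Q x y) :: real) > 0"
    using assms(1) by (simp add: bqf_eval_form_root[OF assms])
  then show "bqf_eval Q x y > 0" by simp
qed

lemma bqf_primitive_bezout:
  assumes "bqf_primitive Q"
  obtains p q r where "p * coeff_a Q + q * coeff_b Q + r * coeff_c Q = 1"
proof -
  obtain u v where uv: "u * coeff_b Q + v * coeff_c Q = gcd (coeff_b Q) (coeff_c Q)"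
    using bezout_int by blast
  obtain p w where "p * coeff_a Q + w * gcd (coeff_b Q) (coeff_c Q) = gcd (coeff_a Q) (gcd (coeff_b Q) (coeff_c Q))"
    using bezout_int by blast
  then have "p * coeff_a Q + w * (u * coeff_b Q + v * coeff_c Q) = 1"
    using assms by (simp add: bqf_primitive_def uv)
  then have "p * coeff_a Q + (w * u) * coeff_b Q + (w * v) * coeff_c Q = 1"
    by (simp add: algebra_simps)
  then show thesis by (rule that)
qed

text \<open>The norm product of \<open>\<int> + \<int>\<tau>\<close> is generated by \<open>1\<close>, \<open>\<tau>\<close>, the trace of \<open>\<tau>\<close> and the norm of \<open>\<tau>\<close>. For the root
of a form these are \<open>1\<close>, \<open>\<tau>\<close>, \<open>b / a\<close> and \<open>c / a\<close>. This lemma and the next give the two inclusions.\<close>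

lemma lat_norm_product:
  assumes "add_subgroup T" "1 \<in> T" "\<tau> \<in> T" "\<tau> + cnj \<tau> \<in> T" "\<tau> * cnj \<tau> \<in> T"
  shows "lprod (lat \<tau>) (cnj ` lat \<tau>) \<subseteq> T"
proof (rule lprod_subset[OF assms(1)])
  fix z w assume "z \<in> lat \<tau>" "w \<in> cnj ` lat \<tau>"
  then obtain x y x' y' where zw: "z = of_int x + of_int y * \<tau>" "w = cnj (of_int x' + of_int y' * \<tau>)"
    by (auto elim!: latE)
  have "z * w = of_int (x * x') * 1 + of_int (x' * y - x * y') * \<tau> + of_int (x * y') * (\<tau> + cnj \<tau>)
      + of_int (y * y') * (\<tau> * cnj \<tau>)"
    by (simp add: zw algebra_simps)
  then show "z * w \<in> T"
    using assms by (simp only: add_subgroupD(4)[OF assms(1)] add_subgroup_of_int_mult)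
qed

lemma lat_norm_product_gens:
  fixes \<tau> :: complex
  defines "P \<equiv> lprod (lat \<tau>) (cnj ` lat \<tau>)"
  shows "1 \<in> P" "\<tau> \<in> P" "\<tau> + cnj \<tau> \<in> P" "\<tau> * cnj \<tau> \<in> P"
proof -
  have 1: "1 \<in> cnj ` lat \<tau>" by (rule image_eqI[OF _ one_in_lat]) simp
  have c: "cnj \<tau> \<in> cnj ` lat \<tau>" by (rule imageI[OF gen_in_lat])
  show "1 \<in> P" using lprodI[OF one_in_lat 1] by (simp add: P_def)
  show t: "\<tau> \<in> P" using lprodI[OF gen_in_lat 1] by (simp add: P_def)
  have "cnj \<tau> \<in> P" using lprodI[OF one_in_lat c] by (simp add: P_def)
  with t show "\<tau> + cnj \<tau> \<in> P" unfolding P_def by (intro add_subgroupD(4)[OF add_subgroup_lprod])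
  show "\<tau> * cnj \<tau> \<in> P" using lprodI[OF gen_in_lat c] by (simp add: P_def)
qed

context quadratic_order
begin

lemma form_root_omega:
  assumes "coeff_a Q > 0" "bqf_disc Q = D"
  shows "\<exists>k. of_int (coeff_a Q) * form_root Q = \<omega> + of_int k"
proof -
  have "coeff_b Q - D = - (coeff_b Q * (coeff_b Q - 1)) + 2 * (2 * coeff_a Q * coeff_c Q)"
    using assms(2) by (simp add: bqf_disc_def algebra_simps power2_eq_square)
  then have "even (coeff_b Q - D)" by simp
  then obtain k where "coeff_b Q - D = 2 * k" unfolding dvd_def by blast
  then have "(of_int (coeff_b Q) :: real) = of_int D + 2 * of_int k"
    by (metis add.commute diff_eq_eq of_int_add of_int_mult of_int_numeral)
  then have "of_int (coeff_a Q) * form_root Q = \<omega> + of_int k"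
    using assms by (simp add: form_root_def complex_eq_iff Im_omega)
  then show ?thesis ..
qed

text \<open>Multiplied by \<open>a\<close>, the generators of the norm product become \<open>a\<close>, \<open>a \<tau> = \<omega> + k\<close>, \<open>b\<close> and \<open>c\<close>. They lie in the
order, and primitivity is exactly what makes them generate \<open>1\<close>, hence also \<open>\<omega>\<close>.\<close>

lemma lprod_form_lattice_cnj:
  assumes a: "coeff_a Q > 0" and D: "bqf_disc Q = D" and prim: "bqf_primitive Q"
  shows "lprod (lat (form_root Q)) (cnj ` lat (form_root Q)) =
    lscale (of_real (1 / of_int (coeff_a Q))) quad_ord" (is "?P = ?R")
proof
  define \<tau> where "\<tau> = form_root Q"
  let ?a = "of_int (coeff_a Q) :: complex"
  have a0: "?a \<noteq> 0" using a by simp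
  have D0: "bqf_disc Q < 0" using D D_neg by simp
  obtain k where k: "?a * \<tau> = \<omega> + of_int k" using form_root_omega[OF a D] unfolding \<tau>_def ..
  have R: "z \<in> lscale (1 / ?a) quad_ord \<longleftrightarrow> z * ?a \<in> quad_ord" for z
    using a0 by (simp add: mem_lscale_iff)
  have addR: "add_subgroup ?R" by (rule add_subgroup_lscale[OF add_subgroup_quad_ord])
  have int: "of_int n \<in> quad_ord" for n using latI[of n 0 \<omega>] by (simp add: quad_ord_def)
  show "?P \<subseteq> ?R"
  proof (rule lat_norm_product[OF addR])
    show "1 \<in> ?R" using int[of "coeff_a Q"] by (simp add: R)
    show "form_root Q \<in> ?R"
      using k add_subgroupD(4)[OF add_subgroup_quad_ord omega_in_quad_ord int[of k]] by (simp add: R \<tau>_def mult.commute)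
    show "form_root Q + cnj (form_root Q) \<in> ?R" using a0 int by (simp add: R form_root_trace)
    show "form_root Q * cnj (form_root Q) \<in> ?R" using a0 int by (simp add: R form_root_norm[OF a D0])
  qed
  obtain p q r where pqr: "p * coeff_a Q + q * coeff_b Q + r * coeff_c Q = 1"
    using bqf_primitive_bezout[OF prim] .
  note gens = lat_norm_product_gens[of "form_root Q"]
  have addP: "add_subgroup ?P" by (rule add_subgroup_lprod)
  have "of_int p * 1 + of_int q * (form_root Q + cnj (form_root Q)) + of_int r * (form_root Q * cnj (form_root Q)) \<in> ?P"
    by (intro add_subgroupD(4)[OF addP] add_subgroup_of_int_mult[OF addP] gens)
  also have "of_int p * 1 + of_int q * (form_root Q + cnj (form_root Q)) + of_int r * (form_root Q * cnj (form_root Q))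
      = of_int (p * coeff_a Q + q * coeff_b Q + r * coeff_c Q) / ?a"
    unfolding form_root_trace form_root_norm[OF a D0] using a0 by (simp add: field_simps)
  finally have 1: "1 / ?a \<in> ?P" by (simp only: pqr of_int_1)
  have "form_root Q - of_int k * (1 / ?a) \<in> ?P"
    by (intro add_subgroupD(2)[OF addP] add_subgroup_of_int_mult[OF addP] gens 1)
  also have "form_root Q - of_int k * (1 / ?a) = \<omega> * (1 / ?a)"
    using k a0 by (simp add: \<tau>_def field_simps)
  finally have "lat \<omega> \<subseteq> {x. x * (1 / ?a) \<in> ?P}"
    using 1 by (intro lat_subset add_subgroup_mult_vimage addP) simp_all
  then show "?R \<subseteq> ?P" by (auto simp: lscale_def quad_ord_def)
qed

lemma invertible_form_lattice:
  assumes a: "coeff_a Q > 0" and D: "bqf_disc Q = D" and prim: "bqf_primitive Q"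
  shows "invertible_lattice (lat (form_root Q))"
proof -
  define \<tau> where "\<tau> = form_root Q"
  have D0: "bqf_disc Q < 0" using D D_neg by simp
  obtain k where k: "of_int (coeff_a Q) * \<tau> = \<omega> + of_int k" using form_root_omega[OF a D] unfolding \<tau>_def ..
  then have om: "\<omega> = of_int (coeff_a Q) * \<tau> - of_int k" by (simp add: algebra_simps)
  have sq: "of_int (coeff_a Q) * (\<tau> * \<tau>) = of_int (coeff_b Q) * \<tau> - of_int (coeff_c Q)"
    unfolding \<tau>_def by (rule form_root_square[OF a D0])
  have 1: "1 * \<omega> \<in> lat \<tau>" using latI[of "- k" "coeff_a Q" \<tau>] by (simp add: om)
  have "\<tau> * \<omega> = of_int (coeff_a Q) * (\<tau> * \<tau>) - of_int k * \<tau>" by (simp add: om algebra_simps)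
  also have "\<dots> = of_int (- coeff_c Q) + of_int (coeff_b Q - k) * \<tau>"
    unfolding sq by (simp add: algebra_simps)
  finally have 2: "\<tau> * \<omega> \<in> lat \<tau>" by (simp only: latI)
  have "lat \<tau> \<subseteq> {x. x * \<omega> \<in> lat \<tau>}"
    using 1 2 by (intro lat_subset add_subgroup_mult_vimage add_subgroup_lat) simp_all
  then have "\<forall>x\<in>lat \<tau>. \<omega> * x \<in> lat \<tau>" by (auto simp: mult.commute)
  then show ?thesis
    unfolding invertible_lattice_def using add_subgroup_lat lprod_form_lattice_cnj[OF assms] a
    by (auto simp: \<tau>_def intro!: exI[of _ "1 / of_int (coeff_a Q)"])
qed

end

section \<open>Every invertible lattice is homothetic to that of a reduced form\<close>

text \<open>Lattice reduction, after scaling a shortest vector to \<open>1\<close>. The vector \<open>\<tau>\<close>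
is no longer than \<open>\<tau> \<plusminus> 1\<close>, which bounds its real part. Any \<open>z \<in> N\<close> can be moved by an element of
\<open>\<int> + \<int>\<tau>\<close> to \<open>w = x + y \<tau>\<close> with \<open>\<bar>x\<bar>, \<bar>y\<bar> \<le> 1/2\<close>. Such a \<open>w\<close> is too short: it violates the minimality of \<open>\<tau>\<close>
unless \<open>y = 0\<close>, and then that of \<open>1\<close> unless \<open>w = 0\<close>.\<close>

lemma minimal_vectors_basis:
  assumes N: "add_subgroup N" "1 \<in> N" "\<tau> \<in> N" and pos: "Im \<tau> > 0"
    and min1: "\<And>z. z \<in> N \<Longrightarrow> z \<noteq> 0 \<Longrightarrow> cmod z \<ge> 1"
    and min2: "\<And>z. z \<in> N \<Longrightarrow> Im z \<noteq> 0 \<Longrightarrow> cmod z \<ge> cmod \<tau>"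
  shows "N = lat \<tau>" "\<bar>Re \<tau>\<bar> \<le> 1 / 2" "cmod \<tau> \<ge> 1"
proof -
  have "(cmod (\<tau> - 1))\<^sup>2 \<ge> (cmod \<tau>)\<^sup>2" "(cmod (\<tau> + 1))\<^sup>2 \<ge> (cmod \<tau>)\<^sup>2"
    using N pos by (auto intro!: power_mono min2 add_subgroupD[OF N(1)])
  then show re: "\<bar>Re \<tau>\<bar> \<le> 1 / 2"
    unfolding cmod_power2 by (simp add: power2_eq_square algebra_simps abs_le_iff)
  show t1: "cmod \<tau> \<ge> 1" using min1[OF N(3)] pos by (cases "\<tau> = 0") auto
  show "N = lat \<tau>"
  proof
    show "lat \<tau> \<subseteq> N" by (rule lat_subset[OF N])
    show "N \<subseteq> lat \<tau>"
    proof
      fix z assume z: "z \<in> N"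
      define v where "v = Im z / Im \<tau>"
      define u where "u = Re z - v * Re \<tau>"
      define x y where "x = u - of_int (round u)" and "y = v - of_int (round v)"
      have x: "\<bar>x\<bar> \<le> 1 / 2" and y: "\<bar>y\<bar> \<le> 1 / 2"
        using of_int_round_abs_le[of u] of_int_round_abs_le[of v]
        by (simp_all add: x_def y_def abs_minus_commute)
      define w where "w = z - (of_int (round u) + of_int (round v) * \<tau>)"
      have "of_int (round u) + of_int (round v) * \<tau> \<in> N"
        using \<open>lat \<tau> \<subseteq> N\<close> latI by blast
      then have w: "w \<in> N" unfolding w_def by (intro add_subgroupD(2)[OF N(1)] z)
      have wre: "Re w = x + y * Re \<tau>" and wim: "Im w = y * Im \<tau>"
        using pos by (simp_all add: w_def x_def y_def u_def v_def field_simps)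
      have xx: "x\<^sup>2 \<le> 1 / 4" and yy: "y\<^sup>2 \<le> 1 / 4"
        using power_mono[OF x, of 2] power_mono[OF y, of 2] by (simp_all add: power2_eq_square)
      have "y = 0"
      proof (rule ccontr)
        assume "y \<noteq> 0"
        then have "(cmod \<tau>)\<^sup>2 \<le> (cmod w)\<^sup>2" using min2[OF w] wim pos by (simp add: power_mono)
        also have "(cmod w)\<^sup>2 = x\<^sup>2 + 2 * (x * y) * Re \<tau> + y\<^sup>2 * (cmod \<tau>)\<^sup>2"
          unfolding cmod_power2 wre wim by (simp add: power2_eq_square algebra_simps)
        also have "2 * (x * y) * Re \<tau> \<le> 1 / 4"
        proof -
          have "\<bar>x * y * Re \<tau>\<bar> \<le> 1 / 2 * (1 / 2) * (1 / 2)"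
            unfolding abs_mult using x y re by (intro mult_mono) auto
          then show ?thesis by (simp add: abs_le_iff)
        qed
        also have "y\<^sup>2 * (cmod \<tau>)\<^sup>2 \<le> 1 / 4 * (cmod \<tau>)\<^sup>2" by (intro mult_right_mono yy) simp
        finally have "(cmod \<tau>)\<^sup>2 \<le> 1 / 2 + 1 / 4 * (cmod \<tau>)\<^sup>2" using xx by linarith
        moreover have "(cmod \<tau>)\<^sup>2 \<ge> 1" using t1 by simp
        ultimately show False by linarith
      qed
      have "w = 0"
      proof (rule ccontr)
        assume "w \<noteq> 0"
        then have "(cmod w)\<^sup>2 \<ge> 1" using min1[OF w] by simp
        then show False using xx unfolding cmod_power2 wre wim \<open>y = 0\<close> by simp
      qed
      then show "z \<in> lat \<tau>" using latI by (simp add: w_def)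
    qed
  qed
qed

text \<open>Only the sign convention on the boundary can fail, when \<open>b < 0\<close>. For \<open>b = -a\<close> the basis
change \<open>\<tau> \<mapsto> \<tau> + 1\<close> makes \<open>b\<close> positive. For \<open>a = c\<close> the root lies on the unit circle and \<open>\<tau> \<mapsto> -1/\<tau>\<close>,
a homothety combined with a basis change, replaces \<open>b\<close> by \<open>-b\<close>.\<close>

lemma weakly_reduced_form_homothetic_reduced:
  assumes "coeff_a Q > 0" "\<bar>coeff_b Q\<bar> \<le> coeff_a Q" "coeff_a Q \<le> coeff_c Q"
    and "bqf_primitive Q" "bqf_disc Q < 0"
  obtains Q' l where "bqf_form Q'" "bqf_disc Q' = bqf_disc Q" "l \<noteq> 0"
    "lat (form_root Q) = lscale l (lat (form_root Q'))"
proof -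
  define a b c \<tau> where "a = coeff_a Q" and "b = coeff_b Q" and "c = coeff_c Q" and "\<tau> = form_root Q"
  note defs = a_def b_def c_def
  have a: "a > 0" using assms by (simp add: defs)
  have pd: "bqf_positive_definite R" if "bqf_disc R = bqf_disc Q" "coeff_a R = a" for R
    by (rule bqf_positive_definiteI) (use that assms in \<open>auto simp: defs\<close>)
  consider "b \<ge> 0 \<or> \<bar>b\<bar> < a \<and> a < c" | "b < 0" "b = - a" | "b < 0" "a = c"
    using assms(2,3) unfolding defs by linarith
  then show thesis
  proof cases
    case 1
    then have "bqf_form Q" using assms pd[of Q] by (auto simp: bqf_form_def bqf_reduced_def defs)
    then show ?thesis by (intro that[of Q 1]) auto
  next
    case 2
    define R where "R = \<lparr>coeff_a = a, coeff_b = a, coeff_c = c\<rparr>"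
    have D: "bqf_disc R = bqf_disc Q" using 2 by (simp add: R_def bqf_disc_def defs)
    have "bqf_form R"
      using assms 2 pd[of R] D by (simp add: bqf_form_def bqf_reduced_def R_def bqf_primitive_def defs)
    moreover have root: "form_root R = \<tau> + 1"
      using 2 a D by (simp add: form_root_def \<tau>_def complex_eq_iff R_def defs[symmetric] field_simps)
    have "lat \<tau> = lat (\<tau> + 1)"
    proof
      have "\<tau> = of_int (-1) + of_int 1 * (\<tau> + 1)" by simp
      then have "\<tau> \<in> lat (\<tau> + 1)" by (metis latI)
      then show "lat \<tau> \<subseteq> lat (\<tau> + 1)" by (intro lat_subset add_subgroup_lat one_in_lat)
      show "lat (\<tau> + 1) \<subseteq> lat \<tau>"
        by (intro lat_subset add_subgroup_lat one_in_lat add_subgroupD(4)[OF add_subgroup_lat] gen_in_lat)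
    qed
    ultimately show ?thesis using D by (intro that[of R 1]) (simp_all add: root \<tau>_def)
  next
    case 3
    define R where "R = \<lparr>coeff_a = a, coeff_b = - b, coeff_c = a\<rparr>"
    have D: "bqf_disc R = bqf_disc Q" using 3 by (simp add: R_def bqf_disc_def defs)
    have form: "bqf_form R"
      using assms 3 pd[of R] D by (simp add: bqf_form_def bqf_reduced_def R_def bqf_primitive_def defs)
    have root: "form_root R = - cnj \<tau>"
      using D by (simp add: form_root_def \<tau>_def complex_eq_iff R_def defs[symmetric])
    have n: "\<tau> * cnj \<tau> = 1"
      using form_root_norm[of Q] assms 3 a unfolding \<tau>_def by (simp add: defs[symmetric])
    then have "\<tau> \<noteq> 0" by auto
    have "lat \<tau> = lscale \<tau> (lat (- cnj \<tau>))"
    proof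
      have "1 / \<tau> = cnj \<tau>" using n \<open>\<tau> \<noteq> 0\<close> by (simp add: field_simps)
      then have "1 / \<tau> = of_int 0 + of_int (-1) * (- cnj \<tau>)" by simp
      then have "1 / \<tau> \<in> lat (- cnj \<tau>)" by (metis latI)
      then show "lat \<tau> \<subseteq> lscale \<tau> (lat (- cnj \<tau>))"
        using \<open>\<tau> \<noteq> 0\<close> by (intro lat_subset add_subgroup_lscale add_subgroup_lat)
          (simp_all add: mem_lscale_iff one_in_lat)
      have "lat (- cnj \<tau>) \<subseteq> {x. x * \<tau> \<in> lat \<tau>}"
        using n add_subgroupD(3)[OF add_subgroup_lat one_in_lat]
        by (intro lat_subset add_subgroup_mult_vimage add_subgroup_lat) (simp_all add: gen_in_lat mult.commute)
      then show "lscale \<tau> (lat (- cnj \<tau>)) \<subseteq> lat \<tau>" by (auto simp: lscale_def mult.commute)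
    qed
    then show ?thesis using form D \<open>\<tau> \<noteq> 0\<close> by (intro that[of R \<tau>]) (simp_all add: root \<tau>_def)
  qed
qed

context quadratic_order
begin

lemma invertible_lattice_norm:
  assumes "lprod M (cnj ` M) = lscale (of_real r) quad_ord" "r > 0" "v \<in> M"
  obtains k :: nat where "(cmod v)\<^sup>2 = r * of_nat k"
proof -
  have "of_real ((cmod v)\<^sup>2) \<in> lscale (of_real r) quad_ord"
    using lprodI[OF assms(3) imageI[OF assms(3), of cnj]] assms(1) by (simp add: cmod_square_eq)
  then obtain k where k: "(cmod v)\<^sup>2 = r * of_int k" by (rule real_quad_ordE) (use assms in auto)
  then have "r * of_int k \<ge> 0" by (metis zero_le_power2)
  then have "k \<ge> 0" using assms(2) by (simp add: zero_le_mult_iff)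
  then show thesis using k that[of "nat k"] by simp
qed

text \<open>If \<open>M\<close> lay on the real line through \<open>\<alpha>\<close>, every product of an element of \<open>M\<close> with a conjugate of one
would be real, but \<open>r \<omega>\<close> is a sum of such products.\<close>

lemma invertible_lattice_noncollinear:
  assumes "invertible_lattice M" "\<alpha> \<noteq> 0"
  obtains \<beta> where "\<beta> \<in> M" "Im (\<beta> / \<alpha>) > 0"
proof -
  obtain r where r: "r > 0" "lprod M (cnj ` M) = lscale (of_real r) quad_ord"
    and add: "add_subgroup M" using assms by (auto simp: invertible_lattice_def)
  have "\<exists>\<beta>\<in>M. Im (\<beta> / \<alpha>) \<noteq> 0"
  proof (rule ccontr)
    assume "\<not> ?thesis"
    then have real: "\<beta> / \<alpha> \<in> \<real>" if "\<beta> \<in> M" for \<beta> using that by (auto simp: complex_is_Real_iff)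
    have "lprod M (cnj ` M) \<subseteq> \<real>"
    proof (rule lprod_subset)
      show "add_subgroup \<real>" by (auto simp: add_subgroup_def)
      fix x y assume "x \<in> M" "y \<in> cnj ` M"
      then obtain z where z: "z \<in> M" "y = cnj z" "x \<in> M" by auto
      have "cnj (z / \<alpha>) = z / \<alpha>" using real[OF z(1)] by (simp only: Reals_cnj_iff)
      then have "(x / \<alpha>) * cnj (z / \<alpha>) * (\<alpha> * cnj \<alpha>) \<in> \<real>"
        using real[OF z(1)] real[OF z(3)]
        by (simp only: cmod_square_eq[symmetric]) (intro Reals_mult Reals_power Reals_of_real)
      then show "x * y \<in> \<real>" using assms(2) by (simp add: z(2))
    qed
    moreover have "of_real r * \<omega> \<in> lscale (of_real r) quad_ord" unfolding lscale_def by (intro imageI omega_in_quad_ord)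
    ultimately have "of_real r * \<omega> \<in> \<real>" using r by auto
    then show False using r Im_omega(1) by (simp add: complex_is_Real_iff)
  qed
  then obtain \<beta> where \<beta>: "\<beta> \<in> M" "Im (\<beta> / \<alpha>) \<noteq> 0" by blast
  show thesis
  proof (cases "Im (\<beta> / \<alpha>) > 0")
    case True then show ?thesis using \<beta> that by blast
  next
    case False
    then have "Im (- \<beta> / \<alpha>) > 0" using \<beta> by simp
    then show ?thesis using add_subgroupD(3)[OF add \<beta>(1)] that by blast
  qed
qed

lemma invertible_lattice_reduced_basis:
  assumes M: "invertible_lattice M"
  obtains \<alpha> \<tau> where "\<alpha> \<noteq> 0" "M = lscale \<alpha> (lat \<tau>)" "Im \<tau> > 0" "\<bar>Re \<tau>\<bar> \<le> 1 / 2" "cmod \<tau> \<ge> 1"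
proof -
  obtain r where r: "r > 0" "lprod M (cnj ` M) = lscale (of_real r) quad_ord"
    and add: "add_subgroup M" using assms by (auto simp: invertible_lattice_def)
  have "\<exists>n :: complex \<Rightarrow> nat. \<forall>v\<in>M. (cmod v)\<^sup>2 = r * of_nat (n v)"
    using invertible_lattice_norm[OF r(2,1)] by (intro bchoice) metis
  then obtain n :: "complex \<Rightarrow> nat" where n: "\<And>v. v \<in> M \<Longrightarrow> (cmod v)\<^sup>2 = r * of_nat (n v)" by blast
  have le: "cmod v \<le> cmod w" if "v \<in> M" "w \<in> M" "n v \<le> n w" for v w
  proof -
    have "(cmod v)\<^sup>2 \<le> (cmod w)\<^sup>2" using that r(1) by (simp add: n)
    then show ?thesis by simp
  qed
  obtain \<beta>0 where "\<beta>0 \<in> M" "Im (\<beta>0 / 1) > 0"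
    using invertible_lattice_noncollinear[OF M, of 1] by auto
  then have "\<beta>0 \<in> M \<and> \<beta>0 \<noteq> 0" by auto
  from ex_has_least_nat[of "\<lambda>v. v \<in> M \<and> v \<noteq> 0", OF this, of n]
  obtain \<alpha> where \<alpha>: "\<alpha> \<in> M" "\<alpha> \<noteq> 0" "\<And>v. v \<in> M \<Longrightarrow> v \<noteq> 0 \<Longrightarrow> cmod \<alpha> \<le> cmod v"
    using le by blast
  obtain \<beta>1 where "\<beta>1 \<in> M \<and> Im (\<beta>1 / \<alpha>) > 0"
    using invertible_lattice_noncollinear[OF M \<alpha>(2)] by blast
  from ex_has_least_nat[of "\<lambda>v. v \<in> M \<and> Im (v / \<alpha>) > 0", OF this, of n]
  obtain \<beta> where \<beta>: "\<beta> \<in> M" "Im (\<beta> / \<alpha>) > 0" "\<And>v. v \<in> M \<Longrightarrow> Im (v / \<alpha>) > 0 \<Longrightarrow> cmod \<beta> \<le> cmod v"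
    using le by blast
  define N where "N = lscale (1 / \<alpha>) M"
  have memN: "z \<in> N \<longleftrightarrow> \<alpha> * z \<in> M" for z
    using \<alpha>(2) by (simp add: N_def mem_lscale_iff mult.commute)
  have N: "add_subgroup N" "1 \<in> N" "\<beta> / \<alpha> \<in> N"
    using \<alpha> \<beta> add by (simp_all add: memN) (simp add: N_def add_subgroup_lscale)
  have min1: "cmod z \<ge> 1" if "z \<in> N" "z \<noteq> 0" for z
    using \<alpha>(3)[of "\<alpha> * z"] that \<alpha>(2) by (simp add: memN norm_mult)
  have min2: "cmod z \<ge> cmod (\<beta> / \<alpha>)" if z: "z \<in> N" "Im z \<noteq> 0" for z
  proof -
    have "cmod \<beta> \<le> cmod (\<alpha> * z)"
    proof (cases "Im z > 0")
      case True then show ?thesis using z \<alpha>(2) \<beta>(3)[of "\<alpha> * z"] by (simp add: memN)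
    next
      case False
      then show ?thesis
        using z \<alpha>(2) \<beta>(3)[of "- (\<alpha> * z)"] add_subgroupD(3)[OF add] by (simp add: memN)
    qed
    then show ?thesis using \<alpha>(2) by (simp add: norm_divide norm_mult field_simps)
  qed
  have "N = lat (\<beta> / \<alpha>)" "\<bar>Re (\<beta> / \<alpha>)\<bar> \<le> 1 / 2" "cmod (\<beta> / \<alpha>) \<ge> 1"
    using minimal_vectors_basis[OF N \<beta>(2) min1 min2] by blast+
  moreover have "M = lscale \<alpha> N" using \<alpha>(2) by (simp add: N_def lscale_lscale)
  ultimately show thesis using \<alpha>(2) \<beta>(2) that by blast
qed

text \<open>By \<open>real_quad_ordE\<close> and the norm equation, \<open>1\<close>, the trace of \<open>\<tau>\<close> and the norm of \<open>\<tau>\<close> are the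
multiples \<open>s a\<close>, \<open>s b\<close> and \<open>s c\<close> of \<open>s\<close> with \<open>a\<close>, \<open>b\<close>, \<open>c\<close> integers, so that \<open>s = 1/a\<close> and \<open>\<tau>\<close> is
a root of \<open>a z\<^sup>2 - b z + c\<close>. Since the norm product is all of \<open>s O\<close>, it
contains \<open>s\<close>, which forces the form to be primitive, and \<open>s \<omega>\<close>, which forces the
imaginary part of \<open>a \<tau>\<close> to be that of \<open>\<omega>\<close>, that is, the discriminant to be \<open>D\<close> and not a proper
square multiple of it.\<close>

lemma invertible_lat_form:
  assumes inv: "invertible_lattice (lat \<tau>)" and pos: "Im \<tau> > 0"
  obtains Q where "coeff_a Q > 0" "bqf_disc Q = D" "bqf_primitive Q" "\<tau> = form_root Q"
proof -
  define P where "P = lprod (lat \<tau>) (cnj ` lat \<tau>)"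
  obtain s where s: "s > 0" and P: "P = lscale (of_real s) quad_ord"
    using inv by (auto simp: invertible_lattice_def P_def)
  note gens = lat_norm_product_gens[of \<tau>, folded P_def]
  have "of_real 1 \<in> lscale (of_real s) quad_ord" using gens(1) P by simp
  then obtain a where a: "1 = s * of_int a" by (rule real_quad_ordE[OF _ s])
  then have "s * of_int a > 0" by linarith
  then have apos: "a > 0" using s by (simp add: zero_less_mult_iff)
  have sa: "s = 1 / of_int a" using a apos by (simp add: field_simps)
  have "of_real ((cmod \<tau>)\<^sup>2) \<in> lscale (of_real s) quad_ord"
    using gens(4) P by (simp add: cmod_square_eq)
  then obtain c where "(cmod \<tau>)\<^sup>2 = s * of_int c" by (rule real_quad_ordE[OF _ s])
  then have c: "of_int a * (cmod \<tau>)\<^sup>2 = of_int c" using apos by (simp add: sa)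
  have "of_real (2 * Re \<tau>) \<in> lscale (of_real s) quad_ord"
    using gens(3) P by (simp add: complex_add_cnj)
  then obtain b where "2 * Re \<tau> = s * of_int b" by (rule real_quad_ordE[OF _ s])
  then have b: "2 * (of_int a * Re \<tau>) = of_int b" using apos by (simp add: sa field_simps)
  obtain u v where "\<tau> = of_real s * (of_int u + of_int v * \<omega>)"
    using gens(2) unfolding P lscale_def quad_ord_def by (auto elim!: latE)
  from arg_cong[OF this, of Im] have v: "of_int a * Im \<tau> = of_int v * Im \<omega>"
    using apos by (simp add: sa)
  define g where "g = Gcd {a, b, c}"
  \<comment> \<open>The generators \<open>1\<close>, \<open>\<tau>\<close>, \<open>b / a\<close>, \<open>c / a\<close> of the norm product all lie in the subgroup \<open>T\<close> generated by \<open>g / a\<close> and \<open>\<tau>\<close>; comparing it with \<open>s O\<close> gives \<open>g = 1\<close> and \<open>v = 1\<close>.\<close>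
  define T where "T = {of_int (g * x) / of_int a + of_int y * \<tau> |x y. True}"
  have TI: "of_int (g * x) / of_int a + of_int y * \<tau> \<in> T" for x y by (auto simp: T_def)
  have addT: "add_subgroup T"
    unfolding add_subgroup_def
  proof (intro conjI ballI)
    show "0 \<in> T" using TI[of 0 0] by simp
    fix z w assume "z \<in> T" "w \<in> T"
    then obtain x y x' y' where "z = of_int (g * x) / of_int a + of_int y * \<tau>"
      "w = of_int (g * x') / of_int a + of_int y' * \<tau>" by (auto simp: T_def)
    then have "z - w = of_int (g * (x - x')) / of_int a + of_int (y - y') * \<tau>"
      by (simp add: algebra_simps diff_divide_distrib)
    then show "z - w \<in> T" by (simp only: TI)
  qed
  have ratT: "of_int n / of_int a \<in> T" if "n \<in> {a, b, c}" for n
  proof -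
    have "g dvd n" using that unfolding g_def by (rule Gcd_dvd)
    then obtain m where "n = g * m" by (auto elim: dvdE)
    then show ?thesis using TI[of m 0] by simp
  qed
  have "P \<subseteq> T"
    unfolding P_def
  proof (rule lat_norm_product[OF addT])
    show "1 \<in> T" using ratT[of a] apos by simp
    show "\<tau> \<in> T" using TI[of 0 1] by simp
    have "\<tau> + cnj \<tau> = of_int b / of_int a"
      using b apos by (simp add: complex_eq_iff field_simps)
    then show "\<tau> + cnj \<tau> \<in> T" using ratT[of b] by simp
    have "\<tau> * cnj \<tau> = of_real (of_int c / of_int a)"
      unfolding complex_norm_square[symmetric] of_real_eq_iff using c apos by (simp add: field_simps)
    then show "\<tau> * cnj \<tau> \<in> T" using ratT[of c] by simp
  qed
  moreover have "of_real s * 1 \<in> P" "of_real s * \<omega> \<in> P"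
    unfolding P lscale_def by (intro imageI one_in_quad_ord omega_in_quad_ord)+
  ultimately obtain x y x' y' where
      one: "of_real s * 1 = of_int (g * x) / of_int a + of_int y * \<tau>"
    and om: "of_real s * \<omega> = of_int (g * x') / of_int a + of_int y' * \<tau>"
    unfolding T_def by blast
  have "y = 0" using arg_cong[OF one, of Im] pos by simp
  with arg_cong[OF one, of Re] have "of_int (g * x) = (1 :: real)" using apos by (simp add: sa)
  then have "g * x = 1" by linarith
  moreover have "g \<ge> 0" by (simp add: g_def)
  ultimately have g: "g = 1" using pos_zmult_eq_1_iff[of g x] by (cases "g = 0") auto
  have "s * Im \<omega> = of_int y' * Im \<tau>" using arg_cong[OF om, of Im] by simp
  then have "Im \<omega> = of_int y' * (of_int a * Im \<tau>)" using apos by (simp add: sa field_simps)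
  then have "Im \<omega> = of_int (y' * v) * Im \<omega>" by (simp add: v)
  then have "of_int (y' * v) = (1 :: real)" using Im_omega(1) by simp
  then have "y' * v = 1" by linarith
  moreover have "v > 0"
  proof -
    have "of_int v * Im \<omega> > 0" using v apos pos by (metis mult_pos_pos of_int_0_less_iff)
    then show ?thesis using Im_omega(1) by (simp add: zero_less_mult_iff)
  qed
  ultimately have "v = 1" using pos_zmult_eq_1_iff[of v y'] by (simp add: mult.commute)
  then have im: "of_int a * Im \<tau> = Im \<omega>" using v by simp
  define Q where "Q = \<lparr>coeff_a = a, coeff_b = b, coeff_c = c\<rparr>"
  have disc: "bqf_disc Q = D"
  proof -
    have "(of_int (bqf_disc Q) :: real) = (2 * (of_int a * Re \<tau>))\<^sup>2 - 4 * of_int a * (of_int a * (cmod \<tau>)\<^sup>2)"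
      by (simp add: Q_def bqf_disc_def b c)
    also have "\<dots> = - 4 * (of_int a * Im \<tau>)\<^sup>2"
      unfolding cmod_power2 by (simp add: power2_eq_square algebra_simps)
    also have "\<dots> = of_int D" using D_neg by (simp add: im Im_omega power_divide)
    finally show ?thesis by simp
  qed
  have "\<tau> = form_root Q"
    using b im apos disc by (simp add: form_root_def complex_eq_iff Im_omega) (simp add: Q_def field_simps)
  moreover have "coeff_a Q > 0" "bqf_primitive Q"
    using apos g by (simp_all add: Q_def bqf_primitive_def g_def)
  ultimately show thesis using disc that by blast
qed

lemma invertible_lattice_reduced_form:
  assumes "invertible_lattice M"
  obtains Q l where "bqf_form Q" "bqf_disc Q = D" "l \<noteq> 0" "M = lscale l (lat (form_root Q))"
proof -
  obtain \<alpha> \<tau> where \<alpha>: "\<alpha> \<noteq> 0" "M = lscale \<alpha> (lat \<tau>)"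
    and \<tau>: "Im \<tau> > 0" "\<bar>Re \<tau>\<bar> \<le> 1 / 2" "cmod \<tau> \<ge> 1"
    using invertible_lattice_reduced_basis[OF assms] .
  have "lat \<tau> = lscale (1 / \<alpha>) M" using \<alpha> by (simp add: lscale_lscale)
  then have "invertible_lattice (lat \<tau>)" using invertible_lattice_lscale[OF assms] \<alpha>(1) by simp
  then obtain Q where Q: "coeff_a Q > 0" "bqf_disc Q = D" "bqf_primitive Q" "\<tau> = form_root Q"
    using invertible_lat_form \<tau>(1) by blast
  have D0: "bqf_disc Q < 0" using Q D_neg by simp
  have "\<bar>of_int (coeff_b Q)\<bar> \<le> (of_int (coeff_a Q) :: real)"
    using \<tau>(2) Q(1) by (simp add: Q(4) form_root_def abs_mult field_simps)
  then have b: "\<bar>coeff_b Q\<bar> \<le> coeff_a Q" by linarith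
  have "of_int (coeff_c Q) = of_int (coeff_a Q) * (cmod \<tau>)\<^sup>2"
    using bqf_eval_form_root[OF Q(1) D0, of 0 1] by (simp add: bqf_eval_def Q(4))
  moreover have "of_int (coeff_a Q) * 1 \<le> of_int (coeff_a Q) * (cmod \<tau>)\<^sup>2"
    using \<tau>(3) Q(1) by (intro mult_left_mono) auto
  ultimately have c: "coeff_a Q \<le> coeff_c Q" by simp
  obtain Q' l where Q': "bqf_form Q'" "bqf_disc Q' = bqf_disc Q" "l \<noteq> 0"
    "lat (form_root Q) = lscale l (lat (form_root Q'))"
    using weakly_reduced_form_homothetic_reduced[OF Q(1) b c Q(3) D0] .
  show thesis
    by (rule that[of Q' "\<alpha> * l"]) (use Q' Q \<alpha> in \<open>simp_all add: lscale_lscale\<close>)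
qed

section \<open>Distinct reduced forms give distinct classes\<close>

lemma form_root_Im:
  assumes "coeff_a Q > 0" "bqf_disc Q = D"
  shows "of_int (coeff_a Q) * Im (form_root Q) = Im \<omega>"
  using assms by (simp add: form_root_def Im_omega)

text \<open>The area of a period parallelogram is compared in two ways: multiplication by \<open>l\<close> scales it by
\<open>\<bar>l\<bar>\<^sup>2\<close>, and a change of basis scales it by the determinant. The areas are \<open>Im \<omega> / a\<close> and \<open>Im \<omega> / a'\<close>.\<close>

lemma homothety_covolume:
  assumes Q: "coeff_a Q > 0" "bqf_disc Q = D" and Q': "coeff_a Q' > 0" "bqf_disc Q' = D"
    and hom: "lscale l (lat (form_root Q)) = lat (form_root Q')"
  obtains p q r s where "l = of_int p + of_int q * form_root Q'"
    "l * form_root Q = of_int r + of_int s * form_root Q'"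
    "(cmod l)\<^sup>2 * of_int (coeff_a Q') = of_int (p * s - q * r) * of_int (coeff_a Q)"
proof -
  define \<tau> \<tau>' where "\<tau> = form_root Q" and "\<tau>' = form_root Q'"
  have "l * 1 \<in> lat \<tau>'" "l * \<tau> \<in> lat \<tau>'"
    unfolding \<tau>'_def hom[symmetric] \<tau>_def lscale_def by (intro imageI one_in_lat gen_in_lat)+
  then obtain p q r s where l: "l = of_int p + of_int q * \<tau>'" and lt: "l * \<tau> = of_int r + of_int s * \<tau>'"
    by (auto elim!: latE)
  have "(cmod l)\<^sup>2 * Im \<tau> = Im (cnj l * (l * \<tau>))"
    unfolding cmod_power2 by (simp add: power2_eq_square algebra_simps)
  also have "\<dots> = of_int (p * s - q * r) * Im \<tau>'"
    unfolding lt unfolding l by (simp add: algebra_simps)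
  finally have "(cmod l)\<^sup>2 * Im \<tau> = of_int (p * s - q * r) * Im \<tau>'" .
  moreover have "Im \<tau> = Im \<omega> / of_int (coeff_a Q)" "Im \<tau>' = Im \<omega> / of_int (coeff_a Q')"
    using form_root_Im[OF Q] form_root_Im[OF Q'] Q(1) Q'(1) by (simp_all add: \<tau>_def \<tau>'_def field_simps)
  ultimately have "(cmod l)\<^sup>2 * (Im \<omega> / of_int (coeff_a Q)) = of_int (p * s - q * r) * (Im \<omega> / of_int (coeff_a Q'))"
    by simp
  then have "((cmod l)\<^sup>2 * of_int (coeff_a Q')) * Im \<omega> = (of_int (p * s - q * r) * of_int (coeff_a Q)) * Im \<omega>"
    using Q(1) Q'(1) by (simp add: field_simps del: of_int_diff of_int_mult)
  then have "(cmod l)\<^sup>2 * of_int (coeff_a Q') = of_int (p * s - q * r) * of_int (coeff_a Q)"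
    using Im_omega(1) by simp
  with l lt show thesis using that unfolding \<tau>_def \<tau>'_def by blast
qed

text \<open>Applying the area comparison to the homothety and to its inverse gives two integers with product \<open>1\<close>,
and the first is positive since multiplication by \<open>l\<close> preserves orientation. Hence the
change of basis is unimodular and \<open>\<bar>l\<bar>\<^sup>2 = a / a'\<close>, which turns the relation between the norms of lattice
points into a proper equivalence of forms.\<close>

lemma homothetic_forms_eq:
  assumes Q: "bqf_form Q" "bqf_disc Q = D" and Q': "bqf_form Q'" "bqf_disc Q' = D" and l: "l \<noteq> 0"
    and hom: "lscale l (lat (form_root Q)) = lat (form_root Q')"
  shows "Q = Q'"
proof -
  have a: "coeff_a Q > 0" "coeff_a Q' > 0" using bqf_form_coeff_bounds Q Q' by blast+
  obtain p q r s where 1: "l = of_int p + of_int q * form_root Q'"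
    "l * form_root Q = of_int r + of_int s * form_root Q'"
    and cov: "(cmod l)\<^sup>2 * of_int (coeff_a Q') = of_int (p * s - q * r) * of_int (coeff_a Q)"
    using homothety_covolume[OF a(1) Q(2) a(2) Q'(2) hom] .
  have "lscale (1 / l) (lat (form_root Q')) = lat (form_root Q)"
    using l by (simp add: hom[symmetric] lscale_lscale)
  from homothety_covolume[OF a(2) Q'(2) a(1) Q(2) this]
  obtain d' where cov': "(cmod (1 / l))\<^sup>2 * of_int (coeff_a Q) = of_int d' * of_int (coeff_a Q')" by metis
  define d where "d = p * s - q * r"
  have "(of_int (d * d') :: real) * (of_int (coeff_a Q) * of_int (coeff_a Q')) =
      (of_int d * of_int (coeff_a Q)) * (of_int d' * of_int (coeff_a Q'))" by simp
  also have "\<dots> = ((cmod l)\<^sup>2 * (cmod (1 / l))\<^sup>2) * (of_int (coeff_a Q) * of_int (coeff_a Q'))"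
    unfolding cov[symmetric, folded d_def] cov'[symmetric] by (simp add: mult_ac)
  also have "(cmod l)\<^sup>2 * (cmod (1 / l))\<^sup>2 = 1"
    using l by (simp add: power_mult_distrib[symmetric] norm_divide)
  finally have "(of_int (d * d') :: real) = 1" using a by simp
  then have "d * d' = 1" by linarith
  moreover have "of_int d * (of_int (coeff_a Q) :: real) > 0"
    unfolding cov[symmetric, folded d_def] using l a by simp
  then have "d > 0" using a by (simp add: zero_less_mult_iff)
  ultimately have d: "d = 1" using pos_zmult_eq_1_iff by blast
  have "bqf_eval Q x y = bqf_eval Q' (p * x + r * y) (q * x + s * y)" for x y
  proof -
    have "of_int (p * x + r * y) + of_int (q * x + s * y) * form_root Q' =
        of_int x * (of_int p + of_int q * form_root Q') + of_int y * (of_int r + of_int s * form_root Q')"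
      by (simp add: algebra_simps)
    also have "\<dots> = l * (of_int x + of_int y * form_root Q)"
      unfolding 1(1)[symmetric] 1(2)[symmetric] by (simp add: algebra_simps)
    finally have "(of_int (bqf_eval Q' (p * x + r * y) (q * x + s * y)) :: real) =
        of_int (coeff_a Q') * (cmod (l * (of_int x + of_int y * form_root Q)))\<^sup>2"
      using a D_neg Q' by (simp add: bqf_eval_form_root)
    also have "\<dots> = ((cmod l)\<^sup>2 * of_int (coeff_a Q')) * (cmod (of_int x + of_int y * form_root Q))\<^sup>2"
      by (simp add: norm_mult power_mult_distrib)
    also have "\<dots> = of_int (bqf_eval Q x y)"
      using a D_neg Q by (simp add: bqf_eval_form_root cov[folded d_def] d)
    finally show ?thesis by simp
  qed
  then show ?thesis
    using properly_equivalent_forms_eq[of Q Q' p s q r] Q Q' d by (simp add: d_def)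
qed

section \<open>Odd class number forces every form to represent a square\<close>

lemma order_class_group: "order (lattice_group Mod principal_lattices) = class_number D"
proof -
  let ?F = "{Q. bqf_form Q \<and> bqf_disc Q = D}"
  let ?f = "\<lambda>Q. principal_lattices #>\<^bsub>lattice_group\<^esub> lat (form_root Q)"
  have inv: "invertible_lattice (lat (form_root Q))" if "Q \<in> ?F" for Q
    using that bqf_form_coeff_bounds(1) by (intro invertible_form_lattice) (auto simp: bqf_form_def)
  have "bij_betw ?f ?F (rcosets\<^bsub>lattice_group\<^esub> principal_lattices)"
  proof (intro bij_betw_imageI inj_onI)
    fix Q Q' assume *: "Q \<in> ?F" "Q' \<in> ?F" "?f Q = ?f Q'"
    have "lat (form_root Q') \<in> ?f Q'"
      unfolding rcos_principal_lattices[OF inv[OF *(2)]] by (auto intro!: exI[of _ 1])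
    then obtain l where "l \<noteq> 0" "lscale l (lat (form_root Q)) = lat (form_root Q')"
      unfolding *(3)[symmetric] rcos_principal_lattices[OF inv[OF *(1)]] by auto
    then show "Q = Q'" using * by (intro homothetic_forms_eq[of Q Q' l]) auto
  next
    show "?f ` ?F = rcosets\<^bsub>lattice_group\<^esub> principal_lattices"
    proof
      show "?f ` ?F \<subseteq> rcosets\<^bsub>lattice_group\<^esub> principal_lattices"
        using inv by (auto simp: RCOSETS_def lattice_group_def)
      show "rcosets\<^bsub>lattice_group\<^esub> principal_lattices \<subseteq> ?f ` ?F"
      proof
        fix X assume "X \<in> rcosets\<^bsub>lattice_group\<^esub> principal_lattices"
        then obtain M where M: "invertible_lattice M" and X: "X = principal_lattices #>\<^bsub>lattice_group\<^esub> M"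
          by (auto simp: RCOSETS_def lattice_group_def)
        obtain Q l where Q: "bqf_form Q" "bqf_disc Q = D" "l \<noteq> 0" "M = lscale l (lat (form_root Q))"
          using invertible_lattice_reduced_form[OF M] .
        have QF: "Q \<in> ?F" using Q by simp
        have "M \<in> ?f Q" unfolding rcos_principal_lattices[OF inv[OF QF]] using Q by auto
        then have "?f Q = X"
          unfolding X using inv[OF QF] subgroup_principal_lattices
          by (intro L.repr_independence) (auto simp: lattice_group_def)
        then show "X \<in> ?f ` ?F" using QF by blast
      qed
    qed
  qed
  then show ?thesis
    unfolding class_number_def order_def FactGroup_def by (simp add: bij_betw_same_card)
qed

text \<open>In a group of order \<open>2 k + 1\<close> the element \<open>x\<close> is the square of \<open>x\<^sup>k\<^sup>+\<^sup>1\<close>.\<close>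

lemma odd_class_number_square_class:
  assumes odd: "odd (class_number D)" and Q: "bqf_form Q" "bqf_disc Q = D"
  obtains M l where "invertible_lattice M" "l \<noteq> 0" "lprod M M = lscale l (lat (form_root Q))"
proof -
  let ?G = "lattice_group Mod principal_lattices"
  interpret F: group ?G by (rule P.factorgroup_is_group)
  have invL: "invertible_lattice (lat (form_root Q))"
    using Q bqf_form_coeff_bounds(1) by (intro invertible_form_lattice) (auto simp: bqf_form_def)
  define x where "x = principal_lattices #>\<^bsub>lattice_group\<^esub> lat (form_root Q)"
  have x: "x \<in> carrier ?G"
    using invL by (auto simp: x_def FactGroup_def RCOSETS_def lattice_group_def)
  obtain k where k: "order ?G = 2 * k + 1" using odd order_class_group by (auto elim: oddE)
  define y where "y = x [^]\<^bsub>?G\<^esub> (k + 1)"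
  have y: "y \<in> carrier ?G" unfolding y_def using x by (rule F.nat_pow_closed)
  have "y \<otimes>\<^bsub>?G\<^esub> y = x [^]\<^bsub>?G\<^esub> ((k + 1) + (k + 1))"
    unfolding y_def using x by (simp only: F.nat_pow_mult)
  also have "(k + 1) + (k + 1) = order ?G + 1" by (simp add: k)
  also have "x [^]\<^bsub>?G\<^esub> (order ?G + 1) = x [^]\<^bsub>?G\<^esub> order ?G \<otimes>\<^bsub>?G\<^esub> x [^]\<^bsub>?G\<^esub> (1::nat)"
    using x by (simp only: F.nat_pow_mult)
  also have "\<dots> = x"
    unfolding F.pow_order_eq_1[OF x] F.nat_pow_eone[OF x] using x by (rule F.l_one)
  finally have yy: "y \<otimes>\<^bsub>?G\<^esub> y = x" .
  obtain M where M: "invertible_lattice M" and yM: "y = principal_lattices #>\<^bsub>lattice_group\<^esub> M"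
    using y by (auto simp: FactGroup_def RCOSETS_def lattice_group_def)
  have "x = principal_lattices #>\<^bsub>lattice_group\<^esub> lprod M M"
    using yy P.rcos_sum[of M M] M by (simp add: yM lattice_group_def)
  moreover have "lprod M M \<in> principal_lattices #>\<^bsub>lattice_group\<^esub> lprod M M"
    unfolding rcos_principal_lattices[OF invertible_lattice_lprod[OF M M]] by (auto intro!: exI[of _ 1])
  ultimately obtain l where "l \<noteq> 0" "lprod M M = lscale l (lat (form_root Q))"
    unfolding x_def rcos_principal_lattices[OF invL] by auto
  then show thesis using M that by blast
qed

text \<open>Taking norm products on both sides of \<open>M M = l L\<close> yields \<open>r\<^sup>2 = \<bar>l\<bar>\<^sup>2 / a\<close>. For nonzero \<open>\<alpha> \<in> M\<close> write
\<open>\<bar>\<alpha>\<bar>\<^sup>2 = r k\<close> and \<open>\<alpha>\<^sup>2 = l (x + y \<tau>)\<close>; then \<open>r\<^sup>2 k\<^sup>2 = \<bar>l\<bar>\<^sup>2 Q(x, y) / a = r\<^sup>2 Q(x, y)\<close>.\<close>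

lemma odd_class_number_represents_square:
  assumes odd: "odd (class_number D)" and Q: "bqf_form Q" "bqf_disc Q = D"
  obtains k where "k > 0" "bqf_represents Q (k\<^sup>2)"
proof -
  define L where "L = lat (form_root Q)"
  have a: "coeff_a Q > 0" using bqf_form_coeff_bounds(1) Q by blast
  have D0: "bqf_disc Q < 0" using Q D_neg by simp
  obtain M l where M: "invertible_lattice M" and l: "l \<noteq> 0" and sq: "lprod M M = lscale l L"
    using odd_class_number_square_class[OF assms] unfolding L_def .
  obtain r where r: "r > 0" "lprod M (cnj ` M) = lscale (of_real r) quad_ord"
    using M by (auto simp: invertible_lattice_def)
  have "lprod (lprod M M) (cnj ` lprod M M) = lprod (lprod M (cnj ` M)) (lprod M (cnj ` M))"
    by (simp add: cnj_lprod lprod_ac)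
  also have "\<dots> = lscale (of_real (r * r)) quad_ord"
    by (simp add: r lprod_lscale_left lprod_lscale_right lscale_lscale lprod_quad_ord_quad_ord)
  finally have 1: "lprod (lscale l L) (cnj ` lscale l L) = lscale (of_real (r * r)) quad_ord"
    by (simp only: sq)
  have "lprod (lscale l L) (cnj ` lscale l L) = lscale (l * cnj l) (lprod L (cnj ` L))"
    by (simp add: cnj_lscale lprod_lscale_left lprod_lscale_right lscale_lscale mult.commute)
  also have "lprod L (cnj ` L) = lscale (of_real (1 / of_int (coeff_a Q))) quad_ord"
    unfolding L_def using lprod_form_lattice_cnj[OF a Q(2)] Q(1) by (simp add: bqf_form_def)
  also have "lscale (l * cnj l) (lscale (of_real (1 / of_int (coeff_a Q))) quad_ord) =
      lscale (of_real ((cmod l)\<^sup>2 / of_int (coeff_a Q))) quad_ord"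
    by (simp add: lscale_lscale cmod_square_eq)
  finally have "r * r = (cmod l)\<^sup>2 / of_int (coeff_a Q)"
    using 1 r l a by (intro lscale_quad_ord_inj) auto
  then have norm_l: "(cmod l)\<^sup>2 = of_int (coeff_a Q) * (r * r)" using a by (simp add: field_simps)
  obtain \<alpha> where "\<alpha> \<in> M" "Im (\<alpha> / 1) > 0" using invertible_lattice_noncollinear[OF M, of 1] by auto
  then have \<alpha>: "\<alpha> \<in> M" "\<alpha> \<noteq> 0" by auto
  obtain k where k: "(cmod \<alpha>)\<^sup>2 = r * of_nat k" using invertible_lattice_norm[OF r(2,1) \<alpha>(1)] .
  have "\<alpha> * \<alpha> \<in> lscale l L" using lprodI[OF \<alpha>(1) \<alpha>(1)] sq by simp
  then obtain x y where xy: "\<alpha> * \<alpha> = l * (of_int x + of_int y * form_root Q)"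
    by (auto simp: L_def lscale_def elim!: latE)
  have "(r * of_nat k)\<^sup>2 = (cmod (\<alpha> * \<alpha>))\<^sup>2"
    by (simp add: k[symmetric] norm_mult power2_eq_square)
  also have "\<dots> = (cmod l)\<^sup>2 * (cmod (of_int x + of_int y * form_root Q))\<^sup>2"
    by (simp add: xy norm_mult power_mult_distrib)
  also have "\<dots> = (r * r) * of_int (bqf_eval Q x y)"
    by (simp add: norm_l bqf_eval_form_root[OF a D0])
  finally have "(r * r) * (of_nat k)\<^sup>2 = (r * r) * of_int (bqf_eval Q x y)"
    by (simp add: power2_eq_square mult_ac)
  then have "(of_nat k)\<^sup>2 = (of_int (bqf_eval Q x y) :: real)" using r by simp
  then have "of_int ((int k)\<^sup>2) = (of_int (bqf_eval Q x y) :: real)" by simp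
  then have "bqf_eval Q x y = (int k)\<^sup>2" by linarith
  moreover have "k > 0" using k \<alpha> by (cases "k = 0") auto
  ultimately show thesis by (intro that[of "int k"]) (auto simp: bqf_represents_def)
qed

end

lemma form_odd_class_number_represents_square:
  assumes Q: "bqf_form Q" and "odd (class_number (bqf_disc Q))"
  obtains k where "k > 0" "bqf_represents Q (k\<^sup>2)"
proof -
  have "quadratic_order (bqf_disc Q)"
  proof
    show "bqf_disc Q < 0" by (rule bqf_form_disc_neg[OF Q])
    \<comment> \<open>Modulo \<open>4\<close>, \<open>D (D - 1)\<close> is \<open>b\<^sup>2 (b\<^sup>2 - 1)\<close>, a product of two even numbers.\<close>
    have "even (coeff_b Q * (coeff_b Q - 1))" "even (coeff_b Q * (coeff_b Q + 1))" by simp_all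
    then have "2 * 2 dvd (coeff_b Q * (coeff_b Q - 1)) * (coeff_b Q * (coeff_b Q + 1))"
      by (rule mult_dvd_mono)
    moreover have "bqf_disc Q * (bqf_disc Q - 1) =
        (coeff_b Q * (coeff_b Q - 1)) * (coeff_b Q * (coeff_b Q + 1)) +
        4 * (coeff_a Q * coeff_c Q * (4 * coeff_a Q * coeff_c Q + 1 - 2 * (coeff_b Q)\<^sup>2))"
      by (simp add: bqf_disc_def algebra_simps power2_eq_square)
    ultimately show "4 dvd bqf_disc Q * (bqf_disc Q - 1)" by simp
  qed
  then show thesis using quadratic_order.odd_class_number_represents_square assms that by blast
qed

lemma bqf_represents_mult_square:
  assumes "bqf_represents Q m"
  shows "bqf_represents Q (m * t\<^sup>2)"
proof -
  obtain x y where "bqf_eval Q x y = m" using assms by (auto simp: bqf_represents_def)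
  then have "bqf_eval Q (t * x) (t * y) = m * t\<^sup>2"
    by (auto simp: bqf_eval_def algebra_simps power2_eq_square)
  then show ?thesis by (auto simp: bqf_represents_def)
qed

theorem corollary5:
  fixes Q1 Q2 :: bqf and D1 D2 :: int
  assumes "bqf_form Q1" and "bqf_form Q2"
    and "bqf_disc Q1 = D1" and "bqf_disc Q2 = D2"
    and "odd (class_number D1)" and "odd (class_number D2)"
  shows "infinite {m :: int. bqf_represents Q1 m \<and> bqf_represents Q2 m}"
proof -
  obtain k1 where k1: "k1 > 0" "bqf_represents Q1 (k1\<^sup>2)"
    using form_odd_class_number_represents_square[of Q1] assms by blast
  obtain k2 where k2: "k2 > 0" "bqf_represents Q2 (k2\<^sup>2)"
    using form_odd_class_number_represents_square[of Q2] assms by blast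
  define f where "f t = (k1 * k2 * int t)\<^sup>2" for t :: nat
  have "inj f"
  proof (rule injI)
    fix s t assume "f s = f t"
    then have "(k1 * k2 * int s)\<^sup>2 = (k1 * k2 * int t)\<^sup>2" by (simp only: f_def)
    then have "k1 * k2 * int s = k1 * k2 * int t"
      by (rule power2_eq_imp_eq) (use k1(1) k2(1) in simp_all)
    then show "s = t" using k1(1) k2(1) by simp
  qed
  then have "infinite (range f)" by (simp add: finite_image_iff)
  moreover have "range f \<subseteq> {m. bqf_represents Q1 m \<and> bqf_represents Q2 m}"
  proof (rule image_subsetI, rule CollectI, rule conjI)
    fix t
    have "f t = k1\<^sup>2 * (k2 * int t)\<^sup>2" "f t = k2\<^sup>2 * (k1 * int t)\<^sup>2"
      by (simp_all add: f_def power_mult_distrib)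
    then show "bqf_represents Q1 (f t)" "bqf_represents Q2 (f t)"
      using bqf_represents_mult_square[OF k1(2), of "k2 * int t"]
        bqf_represents_mult_square[OF k2(2), of "k1 * int t"] by simp_all
  qed
  ultimately show ?thesis by (rule infinite_super[rotated])
qed

end
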